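(* For every integer $m\ge 2$ there exists a two-way entanglement purification protocol (2-EPP) that produces $2^m-m-2$ good EPR pairs from $2^m-1$ EPR pairs if there is up to one error. These protocols exceed the quantum Hamming bound $2^k\sum_{j=0}^{t}3^j\binom{n}{j}\le 2^n$ for $t=1$: this inequality fails for $n=2^m-1$, $k=2^m-m-2$, $t=1$.
   Context: An EPR pair is a two-qubit state $\frac{1}{\sqrt2}(|00\rangle+|11\rangle)$, with the first qubit held by Alice and the second by Bob. In an entanglement purification protocol on $n$ pairs, Alice prepares $n$ EPR pairs and sends the second half of each to Bob through a noisy quantum channel, which acts on the $n$ transmitted qubits. Alice and Bob then process their qubits by local quantum operations (including measurements) and communication over noiseless classical channels. The protocol is a two-way protocol (2-EPP) if classical communication is allowed in both directions, so that each local operation may depend on all measurement results communicated so far. At the end the parties output pairs of qubits (one qubit of each pair with Alice, one with Bob). A 2-EPP produces $k$ good EPR pairs from $n$ pairs with up to $t$ errors if, for every channel of the form $\mathcal{S}\otimes I$, where $\mathcal{S}$ is an arbitrary superoperator (quantum channel) acting on some set of at most $t$ of the $n$ transmitted qubits (the set being unknown to Alice and Bob) and $I$ is the identity on the remaining transmitted qubits, the protocol always (with probability 1) outputs at least $k$ pairs that are exactly (fidelity 1) in the state of perfect EPR pairs. The protocol may not depend on the set of affected qubits or on $\mathcal{S}$. The case $k=0$ is trivial. *)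

theory Defs
  imports Complex_Main "Jordan_Normal_Form.Schur_Decomposition"
begin

section \<open>Finite-dimensional operators\<close>

definition msum :: "nat \<Rightarrow> nat \<Rightarrow> complex mat list \<Rightarrow> complex mat" where
  "msum r c As = foldr (+) As (0\<^sub>m r c)"

definition mtrace :: "complex mat \<Rightarrow> complex" where
  "mtrace A = (\<Sum>i<dim_row A. A $$ (i, i))"

definition kron :: "complex mat \<Rightarrow> complex mat \<Rightarrow> complex mat" where
  "kron A B = mat (dim_row A * dim_row B) (dim_col A * dim_col B)
     (\<lambda>(i, j). A $$ (i div dim_row B, j div dim_col B) * B $$ (i mod dim_row B, j mod dim_col B))"

definition ket_bra :: "complex vec \<Rightarrow> complex mat" where
  "ket_bra v = mat (dim_vec v) (dim_vec v) (\<lambda>(i, j). v $ i * cnj (v $ j))"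

definition trace_preserving :: "nat \<Rightarrow> nat \<Rightarrow> complex mat list \<Rightarrow> bool" where
  "trace_preserving d d' Ks \<longleftrightarrow> set Ks \<subseteq> carrier_mat d' d \<and>
     msum d d (map (\<lambda>K. mat_adjoint K * K) Ks) = 1\<^sub>m d"

text \<open>Superoperators are given in operator-sum form by a list of Kraus operators;
  \<open>d'\<close> is the output dimension.\<close>

definition apply_kraus :: "nat \<Rightarrow> complex mat list \<Rightarrow> complex mat \<Rightarrow> complex mat" where
  "apply_kraus d' Ks \<rho> = msum d' d' (map (\<lambda>K. K * \<rho> * mat_adjoint K) Ks)"

section \<open>EPR pairs\<close>

definition epr_amp :: "bool \<Rightarrow> bool \<Rightarrow> complex" where
  "epr_amp x y = (if x = y then 1 / complex_of_real (sqrt 2) else 0)"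

text \<open>A basis state of \<open>n\<close> qubits is an index below \<open>2 ^ n\<close> whose bit \<open>q\<close> is the value of
  qubit \<open>q\<close>.  A joint state of Alice (dimension \<open>dA\<close>) and Bob (dimension \<open>dB\<close>) uses the index
  \<open>a * dB + b\<close>, as in \<^const>\<open>kron\<close>.  So \<open>epr_state n\<close> is the tensor product of \<open>n\<close> EPR pairs
  with the factors regrouped as (Alice's \<open>n\<close> qubits) \<open>\<otimes>\<close> (Bob's \<open>n\<close> qubits); pair \<open>q\<close> consists
  of qubit \<open>q\<close> of Alice and qubit \<open>q\<close> of Bob.\<close>

definition epr_state :: "nat \<Rightarrow> complex vec" where
  "epr_state n = vec (2 ^ n * 2 ^ n)
     (\<lambda>i. \<Prod>q<n. epr_amp (bit (i div 2 ^ n) q) (bit (i mod 2 ^ n) q))"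

section \<open>Channels acting on a subset of the transmitted qubits\<close>

definition sub_index :: "nat set \<Rightarrow> nat \<Rightarrow> nat" where
  "sub_index S i = (\<Sum>l<card S. of_bool (bit i (sorted_list_of_set S ! l)) * 2 ^ l)"

text \<open>\<open>F\<close>, an operator on \<open>card S\<close> qubits, applied to the qubits in \<open>S\<close> and tensored with the
  identity on the other qubits.\<close>

definition on_qubits :: "nat \<Rightarrow> nat set \<Rightarrow> complex mat \<Rightarrow> complex mat" where
  "on_qubits n S F = mat (2 ^ n) (2 ^ n)
     (\<lambda>(i, j). if \<forall>q<n. q \<notin> S \<longrightarrow> bit i q = bit j q
               then F $$ (sub_index S i, sub_index S j) else 0)"

text \<open>Joint state after Bob's halves of \<open>n\<close> EPR pairs went through the channel that has the
  Kraus operators \<open>Fs\<close> on the qubits in \<open>S\<close> and is the identity elsewhere.\<close>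

definition noisy_pairs :: "nat \<Rightarrow> nat set \<Rightarrow> complex mat list \<Rightarrow> complex mat" where
  "noisy_pairs n S Fs =
     apply_kraus (2 ^ n * 2 ^ n) (map (\<lambda>F. kron (1\<^sub>m (2 ^ n)) (on_qubits n S F)) Fs)
       (ket_bra (epr_state n))"

section \<open>Two-way entanglement purification protocols\<close>

text \<open>A protocol is a finitely branching tree of local operations.  In
  \<open>Alice_Op d' Kss next\<close>, Alice performs a quantum instrument on her system, with new local
  dimension \<open>d'\<close>; outcome \<open>i\<close> is the trace non-increasing map with Kraus operators \<open>Kss ! i\<close>.
  The outcome is sent to the other party, and the protocol goes on with \<open>next i\<close>;
  only \<open>i < length Kss\<close> matters.  \<open>Output k\<close> ends the protocol: each party holds \<open>k\<close> qubits,
  which form the \<open>k\<close> output pairs.  Local ancillas, unitaries and discarded subsystems are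
  instruments with a single outcome.\<close>

datatype two_epp =
    Output nat
  | Alice_Op nat "complex mat list list" "nat \<Rightarrow> two_epp"
  | Bob_Op nat "complex mat list list" "nat \<Rightarrow> two_epp"

primrec wf_epp :: "two_epp \<Rightarrow> nat \<Rightarrow> nat \<Rightarrow> bool" where
  "wf_epp (Output k) dA dB \<longleftrightarrow> dA = 2 ^ k \<and> dB = 2 ^ k"
| "wf_epp (Alice_Op d' Kss next) dA dB \<longleftrightarrow>
     trace_preserving dA d' (concat Kss) \<and> (\<forall>i<length Kss. wf_epp (next i) d' dB)"
| "wf_epp (Bob_Op d' Kss next) dA dB \<longleftrightarrow>
     trace_preserving dB d' (concat Kss) \<and> (\<forall>i<length Kss. wf_epp (next i) dA d')"

text \<open>The results of all branches: number of output pairs and unnormalized output state.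
  The trace of the latter is the probability of the branch.\<close>

primrec branches :: "two_epp \<Rightarrow> nat \<Rightarrow> nat \<Rightarrow> complex mat \<Rightarrow> (nat \<times> complex mat) set" where
  "branches (Output k) dA dB \<rho> = {(k, \<rho>)}"
| "branches (Alice_Op d' Kss next) dA dB \<rho> =
     (\<Union>i<length Kss. branches (next i) d' dB
        (apply_kraus (d' * dB) (map (\<lambda>K. kron K (1\<^sub>m dB)) (Kss ! i)) \<rho>))"
| "branches (Bob_Op d' Kss next) dA dB \<rho> =
     (\<Union>i<length Kss. branches (next i) dA d'
        (apply_kraus (dA * d') (map (\<lambda>K. kron (1\<^sub>m dA) K) (Kss ! i)) \<rho>))"

definition is_two_epp :: "two_epp \<Rightarrow> nat \<Rightarrow> bool" where
  "is_two_epp P n \<longleftrightarrow> wf_epp P (2 ^ n) (2 ^ n)"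

definition produces_good_pairs :: "two_epp \<Rightarrow> nat \<Rightarrow> nat \<Rightarrow> nat \<Rightarrow> bool" where
  "produces_good_pairs P k n t \<longleftrightarrow>
     (\<forall>S Fs. S \<subseteq> {..<n} \<longrightarrow> card S \<le> t \<longrightarrow> trace_preserving (2 ^ card S) (2 ^ card S) Fs \<longrightarrow>
       (\<forall>(k', \<sigma>) \<in> branches P (2 ^ n) (2 ^ n) (noisy_pairs n S Fs). mtrace \<sigma> \<noteq> 0 \<longrightarrow>
          k \<le> k' \<and> (1 / mtrace \<sigma>) \<cdot>\<^sub>m \<sigma> = ket_bra (epr_state k')))"

definition quantum_hamming_bound :: "nat \<Rightarrow> nat \<Rightarrow> nat \<Rightarrow> bool" where
  "quantum_hamming_bound n k t \<longleftrightarrow> 2 ^ k * (\<Sum>j\<le>t. 3 ^ j * (n choose j)) \<le> (2 ^ n :: nat)"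

end

theory Submission
  imports Defs
begin

text \<open>Write the joint pure state with amplitudes \<open>M x y\<close> as a matrix \<open>M\<close>. Alice's \<open>K\<close> acts by
  \<open>M \<mapsto> K M\<close>, Bob's by \<open>M \<mapsto> M K\<^sup>T\<close>, and EPR pairs are multiples of the identity; hence a protocol
  whose outcomes all have a single Kraus operator succeeds as soon as it maps every error matrix to
  a multiple of the identity in each branch.

  Both parties first measure the \<open>Z\<close>-parity of all \<open>n = 2 ^ m - 1\<close> qubits. If the results agree,
  the error is a combination of \<open>I\<close> and \<open>Z\<close> on some qubit; the \<open>m\<close> parity checks of the Hamming code,
  measured in the \<open>X\<close>-basis, locate it, and these commute with the first measurement because the
  simplex code has even weights. If the results differ, the error is a combination of \<open>X\<close> and \<open>Y\<close> on
  some qubit, which a binary search with \<open>Z\<close>-parities of nested sets locates in \<open>m\<close> adaptive steps.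
  The last set is the single qubit \<open>q\<close> itself, so \<open>Z\<close> on \<open>q\<close> has been measured and \<open>X\<close> and \<open>Y\<close> need
  not be distinguished: this degeneracy is what beats the Hamming bound. Either way \<open>m + 1\<close> pairs
  are used up.\<close>

section \<open>Operators on bipartite states\<close>

lemma sum_lessThan_mult:
  fixes f :: "nat \<Rightarrow> 'a::comm_monoid_add"
  shows "(\<Sum>p<a * b. f p) = (\<Sum>x<a. \<Sum>y<b. f (x * b + y))"
proof (induction a)
  case (Suc a)
  have shift: "(\<Sum>p<c + b. f p) = (\<Sum>p<c. f p) + (\<Sum>y<b. f (c + y))" for c
    by (induction b) (simp_all add: add.assoc)
  have "(\<Sum>p<Suc a * b. f p) = (\<Sum>p<a * b + b. f p)" by (simp add: add.commute)
  then show ?case using Suc by (simp add: shift)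
qed simp

lemma msum_closed:
  assumes "set As \<subseteq> carrier_mat r c" shows "msum r c As \<in> carrier_mat r c"
  using assms unfolding msum_def by (induction As) auto

lemma msum_index:
  assumes "set As \<subseteq> carrier_mat r c" "i < r" "j < c"
  shows "msum r c As $$ (i, j) = (\<Sum>A\<leftarrow>As. A $$ (i, j))"
  using assms
proof (induction As)
  case (Cons A As)
  have "msum r c As \<in> carrier_mat r c" using Cons.prems by (intro msum_closed) simp
  then show ?case using Cons by (simp add: msum_def)
qed (simp add: msum_def)

lemma mat_adjoint_eq: "mat_adjoint A = mat (dim_col A) (dim_row A) (\<lambda>(i, j). cnj (A $$ (j, i)))"
  unfolding mat_adjoint_def
  by (rule eq_matI) (auto simp: mat_of_rows_def conjugate_complex_def)

text \<open>Entrywise form of the completeness relation, in which the instruments below, given by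
  explicit coefficients, can be checked by evaluating sums.\<close>

lemma trace_preserving_iff:
  assumes "set Ks \<subseteq> carrier_mat d' d"
  shows "trace_preserving d d' Ks \<longleftrightarrow> (\<forall>i<d. \<forall>j<d.
    (\<Sum>K\<leftarrow>Ks. \<Sum>r<d'. cnj (K $$ (r, i)) * K $$ (r, j)) = of_bool (i = j))"
proof -
  have c: "set (map (\<lambda>K. mat_adjoint K * K) Ks) \<subseteq> carrier_mat d d"
    using assms by (fastforce simp: mat_adjoint_eq)
  have "(mat_adjoint K * K) $$ (i, j) = (\<Sum>r<d'. cnj (K $$ (r, i)) * K $$ (r, j))"
    if "K \<in> set Ks" "i < d" "j < d" for K i j
  proof -
    have "K \<in> carrier_mat d' d" using that assms by auto
    then show ?thesis using that
      by (auto simp: mat_adjoint_eq scalar_prod_def atLeast0LessThan intro!: sum.cong)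
  qed
  then have e: "msum d d (map (\<lambda>K. mat_adjoint K * K) Ks) $$ (i, j) =
      (\<Sum>K\<leftarrow>Ks. \<Sum>r<d'. cnj (K $$ (r, i)) * K $$ (r, j))" if "i < d" "j < d" for i j
    using that by (simp add: msum_index[OF c] comp_def cong: map_cong)
  show ?thesis
    unfolding trace_preserving_def using assms msum_closed[OF c] e
    by (auto simp: mat_eq_iff)
qed

text \<open>Each \<open>M\<close> in the list is an unnormalized pure joint state with amplitude \<open>M x y\<close> at Alice's \<open>x\<close> and
  Bob's \<open>y\<close>; only the values at \<open>x < dA\<close>, \<open>y < dB\<close> matter.\<close>

definition mixture :: "nat \<Rightarrow> nat \<Rightarrow> (nat \<Rightarrow> nat \<Rightarrow> complex) list \<Rightarrow> complex mat" where
  "mixture dA dB Ms = mat (dA * dB) (dA * dB)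
     (\<lambda>(i, j). \<Sum>M\<leftarrow>Ms. M (i div dB) (i mod dB) * cnj (M (j div dB) (j mod dB)))"

definition act_left :: "nat \<Rightarrow> complex mat \<Rightarrow> (nat \<Rightarrow> nat \<Rightarrow> complex) \<Rightarrow> nat \<Rightarrow> nat \<Rightarrow> complex" where
  "act_left dA K M = (\<lambda>a y. \<Sum>x<dA. K $$ (a, x) * M x y)"

text \<open>The transpose of \<open>K\<close> enters rather than its adjoint: operators act linearly
  on amplitudes, and conjugation appears only in \<open>mixture\<close>.\<close>

definition act_right :: "nat \<Rightarrow> complex mat \<Rightarrow> (nat \<Rightarrow> nat \<Rightarrow> complex) \<Rightarrow> nat \<Rightarrow> nat \<Rightarrow> complex" where
  "act_right dB K M = (\<lambda>x b. \<Sum>y<dB. K $$ (b, y) * M x y)"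

lemma mixture_dims: "dim_row (mixture dA dB Ms) = dA * dB" "dim_col (mixture dA dB Ms) = dA * dB"
  by (simp_all add: mixture_def)

text \<open>Conjugation by \<open>K\<close> sends the rank-one operator of a vector to that of its
  image under \<open>K\<close>, so pure components stay pure.\<close>

lemma conjugation_rank_one_index:
  assumes "K \<in> carrier_mat D' D" "i < D'" "j < D'"
  shows "(K * mat D D (\<lambda>(p, q). \<Sum>M\<leftarrow>Ms. v M p * cnj (v M q)) * mat_adjoint K) $$ (i, j) =
    (\<Sum>M\<leftarrow>Ms. (\<Sum>p<D. K $$ (i, p) * v M p) * cnj (\<Sum>p<D. K $$ (j, p) * v M p))"
proof -
  have "(K * mat D D (\<lambda>(p, q). \<Sum>M\<leftarrow>Ms. v M p * cnj (v M q)) * mat_adjoint K) $$ (i, j) =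
    (\<Sum>q<D. (\<Sum>p<D. K $$ (i, p) * (\<Sum>M\<leftarrow>Ms. v M p * cnj (v M q))) * cnj (K $$ (j, q)))"
    using assms
    by (auto simp: mat_adjoint_eq scalar_prod_def atLeast0LessThan intro!: sum.cong)
  also have "\<dots> = (\<Sum>M\<leftarrow>Ms. (\<Sum>p<D. K $$ (i, p) * v M p) * cnj (\<Sum>p<D. K $$ (j, p) * v M p))"
    by (induction Ms)
       (simp_all add: algebra_simps sum.distrib sum_distrib_left sum_distrib_right sum_list_addf)
  finally show ?thesis .
qed

lemma pair_index_less:
  assumes "i < a * (b::nat)" shows "i div b < a" "i mod b < b"
  using assms by (auto simp: less_mult_imp_div_less) (metis mod_less_divisor mult_0_right not_less_zero neq0_conv)

lemma pair_index_bound: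
  assumes "x < a" "y < (b::nat)" shows "x * b + y < a * b"
proof -
  have "x * b + y < Suc x * b" using assms by simp
  also have "\<dots> \<le> a * b" using assms by (intro mult_le_mono1) simp
  finally show ?thesis .
qed

text \<open>The identity factor is a Kronecker delta on Bob's index, so only the sum over Alice's
  index survives.\<close>

lemma kron_one_right_sum:
  assumes "K \<in> carrier_mat d' dA" "i < d' * dB"
  shows "(\<Sum>p<dA * dB. kron K (1\<^sub>m dB) $$ (i, p) * M (p div dB) (p mod dB)) =
    act_left dA K M (i div dB) (i mod dB)"
proof -
  note l = pair_index_less[OF assms(2)]
  have "kron K (1\<^sub>m dB) $$ (i, x * dB + y) = (if y = i mod dB then K $$ (i div dB, x) else 0)"
    if "x < dA" "y < dB" for x y
    using that assms l pair_index_bound[OF that] by (auto simp: kron_def)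
  then have "(\<Sum>p<dA * dB. kron K (1\<^sub>m dB) $$ (i, p) * M (p div dB) (p mod dB)) =
      (\<Sum>x<dA. \<Sum>y<dB. (if y = i mod dB then K $$ (i div dB, x) * M x y else 0))"
    unfolding sum_lessThan_mult by (intro sum.cong refl) (simp add: pair_index_bound)
  also have "\<dots> = act_left dA K M (i div dB) (i mod dB)"
    using l unfolding act_left_def by (intro sum.cong refl) simp
  finally show ?thesis .
qed

lemma kron_one_left_sum:
  assumes "K \<in> carrier_mat d' dB" "i < dA * d'"
  shows "(\<Sum>p<dA * dB. kron (1\<^sub>m dA) K $$ (i, p) * M (p div dB) (p mod dB)) =
    act_right dB K M (i div d') (i mod d')"
proof -
  note l = pair_index_less[OF assms(2)]
  have "kron (1\<^sub>m dA) K $$ (i, x * dB + y) = (if x = i div d' then K $$ (i mod d', y) else 0)"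
    if "x < dA" "y < dB" for x y
    using that assms l pair_index_bound[OF that] by (auto simp: kron_def)
  then have "(\<Sum>p<dA * dB. kron (1\<^sub>m dA) K $$ (i, p) * M (p div dB) (p mod dB)) =
      (\<Sum>x<dA. \<Sum>y<dB. (if x = i div d' then K $$ (i mod d', y) * M x y else 0))"
    unfolding sum_lessThan_mult by (intro sum.cong refl) (simp add: pair_index_bound)
  also have "\<dots> = act_right dB K M (i div d') (i mod d')"
    using l unfolding act_right_def by (subst sum.swap) simp
  finally show ?thesis .
qed

lemma kron_carrier: "A \<in> carrier_mat a b \<Longrightarrow> B \<in> carrier_mat c d \<Longrightarrow> kron A B \<in> carrier_mat (a * c) (b * d)"
  by (auto simp: kron_def)

text \<open>Common core of the two one-sided versions: \<open>lift\<close> extends a local operator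
  to the joint system and \<open>act\<close> is its effect on amplitude matrices. Each Kraus
  operator contributes one image of each pure component.\<close>

lemma apply_kraus_mixture:
  assumes Ks: "\<And>K. K \<in> set Ks \<Longrightarrow> lift K \<in> carrier_mat (dA' * dB') (dA * dB)"
    and sums: "\<And>K M i. K \<in> set Ks \<Longrightarrow> i < dA' * dB' \<Longrightarrow>
      (\<Sum>p<dA * dB. lift K $$ (i, p) * M (p div dB) (p mod dB)) = act K M (i div dB') (i mod dB')"
  shows "apply_kraus (dA' * dB') (map lift Ks) (mixture dA dB Ms) =
    mixture dA' dB' (concat (map (\<lambda>K. map (act K) Ms) Ks))"
proof -
  let ?f = "\<lambda>K. lift K * mixture dA dB Ms * mat_adjoint (lift K)"
  have c: "set (map ?f Ks) \<subseteq> carrier_mat (dA' * dB') (dA' * dB')"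
    using Ks by (fastforce simp: mat_adjoint_eq)
  have e: "?f K $$ (i, j) = (\<Sum>M\<leftarrow>map (act K) Ms. M (i div dB') (i mod dB') * cnj (M (j div dB') (j mod dB')))"
    if "K \<in> set Ks" "i < dA' * dB'" "j < dA' * dB'" for K i j
    unfolding mixture_def conjugation_rank_one_index[OF Ks[OF that(1)] that(2,3),
        of "\<lambda>M p. M (p div dB) (p mod dB)"]
    using sums that by (simp add: comp_def)
  have i: "msum (dA' * dB') (dA' * dB') (map ?f Ks) $$ (i, j) =
      mixture dA' dB' (concat (map (\<lambda>K. map (act K) Ms) Ks)) $$ (i, j)"
    if "i < dA' * dB'" "j < dA' * dB'" for i j
  proof -
    have "msum (dA' * dB') (dA' * dB') (map ?f Ks) $$ (i, j) =
      (\<Sum>K\<leftarrow>Ks. \<Sum>M\<leftarrow>map (act K) Ms. M (i div dB') (i mod dB') * cnj (M (j div dB') (j mod dB')))"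
      using that e by (simp add: msum_index[OF c] comp_def cong: map_cong)
    also have "\<dots> = mixture dA' dB' (concat (map (\<lambda>K. map (act K) Ms) Ks)) $$ (i, j)"
      using that by (simp add: mixture_def) (induction Ks; simp)
    finally show ?thesis .
  qed
  have "msum (dA' * dB') (dA' * dB') (map ?f Ks) \<in> carrier_mat (dA' * dB') (dA' * dB')"
    using c by (rule msum_closed)
  then show ?thesis unfolding apply_kraus_def
    by (intro eq_matI) (simp_all add: i comp_def mixture_dims)
qed

lemma apply_kraus_left:
  assumes "set Ks \<subseteq> carrier_mat d' dA"
  shows "apply_kraus (d' * dB) (map (\<lambda>K. kron K (1\<^sub>m dB)) Ks) (mixture dA dB Ms) =
    mixture d' dB (concat (map (\<lambda>K. map (act_left dA K) Ms) Ks))"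
  using assms by (intro apply_kraus_mixture kron_one_right_sum kron_carrier) auto

lemma apply_kraus_right:
  assumes "set Ks \<subseteq> carrier_mat d' dB"
  shows "apply_kraus (dA * d') (map (\<lambda>K. kron (1\<^sub>m dA) K) Ks) (mixture dA dB Ms) =
    mixture dA d' (concat (map (\<lambda>K. map (act_right dB K) Ms) Ks))"
  using assms by (intro apply_kraus_mixture kron_one_left_sum kron_carrier) auto

section \<open>Composing protocols\<close>

definition good_outputs :: "nat \<Rightarrow> (nat \<times> complex mat) set \<Rightarrow> bool" where
  "good_outputs k R \<longleftrightarrow> (\<forall>(k', \<sigma>) \<in> R. mtrace \<sigma> \<noteq> 0 \<longrightarrow>
     k \<le> k' \<and> (1 / mtrace \<sigma>) \<cdot>\<^sub>m \<sigma> = ket_bra (epr_state k'))"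

lemma good_outputs_UN: "good_outputs k (\<Union>i\<in>I. R i) \<longleftrightarrow> (\<forall>i\<in>I. good_outputs k (R i))"
  unfolding good_outputs_def by blast

text \<open>The set stands for the error matrices still possible given the results so far. The
  protocol is chosen before the mixture, so it may depend on this set only; lists of any length
  occur because a channel can have several Kraus operators.\<close>

definition purifiable :: "nat \<Rightarrow> nat \<Rightarrow> nat \<Rightarrow> (nat \<Rightarrow> nat \<Rightarrow> complex) set \<Rightarrow> bool" where
  "purifiable k dA dB \<M> \<longleftrightarrow> (\<exists>P. wf_epp P dA dB \<and> (\<forall>Ms. set Ms \<subseteq> \<M> \<longrightarrow>
     good_outputs k (branches P dA dB (mixture dA dB Ms))))"

lemma instrument_trace_preserving:
  assumes "\<And>x x'. x < d \<Longrightarrow> x' < d \<Longrightarrow>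
    (\<Sum>i<N. \<Sum>a<d'. cnj (f i a x) * f i a x') = of_bool (x = x')"
  shows "trace_preserving d d' (concat (map (\<lambda>i. [mat d' d (\<lambda>(a, x). f i a x)]) [0..<N]))"
proof -
  have c: "concat (map (\<lambda>i. [mat d' d (\<lambda>(a, x). f i a x)]) [0..<N]) =
      map (\<lambda>i. mat d' d (\<lambda>(a, x). f i a x)) [0..<N]"
    by (simp add: concat_map_singleton)
  have "set (map (\<lambda>i. mat d' d (\<lambda>(a, x). f i a x)) [0..<N]) \<subseteq> carrier_mat d' d" by auto
  then show ?thesis using assms
    unfolding c by (subst trace_preserving_iff)
      (auto simp: comp_def interv_sum_list_conv_sum_set_nat atLeast0LessThan)
qed

text \<open>Protocols are built from the end: if each outcome \<open>i\<close> moves every possible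
  error matrix into a purifiable set, the protocols for these sets serve as continuations.\<close>

lemma purifiable_Alice:
  fixes N :: nat
  assumes tp: "\<And>x x'. x < dA \<Longrightarrow> x' < dA \<Longrightarrow>
      (\<Sum>i<N. \<Sum>a<d'. cnj (f i a x) * f i a x') = of_bool (x = x')"
    and nxt: "\<And>i. i < N \<Longrightarrow> purifiable k d' dB (\<N> i)"
    and step: "\<And>i M. i < N \<Longrightarrow> M \<in> \<M> \<Longrightarrow> act_left dA (mat d' dA (\<lambda>(a, x). f i a x)) M \<in> \<N> i"
  shows "purifiable k dA dB \<M>"
proof -
  define K where "K i = mat d' dA (\<lambda>(a, x). f i a x)" for i
  let ?good = "\<lambda>P i. wf_epp P d' dB \<and> (\<forall>Ms. set Ms \<subseteq> \<N> i \<longrightarrow>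
     good_outputs k (branches P d' dB (mixture d' dB Ms)))"
  \<comment> \<open>The bound on \<open>i\<close> stands under the existential quantifier, so that
    the choice yields a total function, as the constructor requires.\<close>
  have "\<forall>i. \<exists>P. i < N \<longrightarrow> ?good P i"
    using nxt unfolding purifiable_def by blast
  then obtain cont where n: "\<And>i. i < N \<Longrightarrow> ?good (cont i) i" by metis
  have a: "apply_kraus (d' * dB) [kron (K i) (1\<^sub>m dB)] (mixture dA dB Ms) =
      mixture d' dB (map (act_left dA (K i)) Ms)" for i Ms
    using apply_kraus_left[of "[K i]" d' dA dB Ms] by (simp add: K_def)
  have s: "set (map (act_left dA (K i)) Ms) \<subseteq> \<N> i" if "i < N" "set Ms \<subseteq> \<M>" for i Ms
    using that step unfolding K_def by auto
  show ?thesis unfolding purifiable_def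
  proof (intro exI conjI allI impI)
    let ?P = "Alice_Op d' (map (\<lambda>i. [K i]) [0..<N]) cont"
    show "wf_epp ?P dA dB"
      using n instrument_trace_preserving[OF tp] by (simp add: K_def)
    fix Ms assume "set Ms \<subseteq> \<M>"
    then show "good_outputs k (branches ?P dA dB (mixture dA dB Ms))"
      using n s by (simp add: a good_outputs_UN)
  qed
qed

lemma purifiable_Bob:
  fixes N :: nat
  assumes tp: "\<And>y y'. y < dB \<Longrightarrow> y' < dB \<Longrightarrow>
      (\<Sum>i<N. \<Sum>b<d'. cnj (f i b y) * f i b y') = of_bool (y = y')"
    and nxt: "\<And>i. i < N \<Longrightarrow> purifiable k dA d' (\<N> i)"
    and step: "\<And>i M. i < N \<Longrightarrow> M \<in> \<M> \<Longrightarrow> act_right dB (mat d' dB (\<lambda>(b, y). f i b y)) M \<in> \<N> i"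
  shows "purifiable k dA dB \<M>"
proof -
  define K where "K i = mat d' dB (\<lambda>(b, y). f i b y)" for i
  let ?good = "\<lambda>P i. wf_epp P dA d' \<and> (\<forall>Ms. set Ms \<subseteq> \<N> i \<longrightarrow>
     good_outputs k (branches P dA d' (mixture dA d' Ms)))"
  have "\<forall>i. \<exists>P. i < N \<longrightarrow> ?good P i"
    using nxt unfolding purifiable_def by blast
  then obtain cont where n: "\<And>i. i < N \<Longrightarrow> ?good (cont i) i" by metis
  have a: "apply_kraus (dA * d') [kron (1\<^sub>m dA) (K i)] (mixture dA dB Ms) =
      mixture dA d' (map (act_right dB (K i)) Ms)" for i Ms
    using apply_kraus_right[of "[K i]" d' dB dA Ms] by (simp add: K_def)
  have s: "set (map (act_right dB (K i)) Ms) \<subseteq> \<N> i" if "i < N" "set Ms \<subseteq> \<M>" for i Ms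
    using that step unfolding K_def by auto
  show ?thesis unfolding purifiable_def
  proof (intro exI conjI allI impI)
    let ?P = "Bob_Op d' (map (\<lambda>i. [K i]) [0..<N]) cont"
    show "wf_epp ?P dA dB"
      using n instrument_trace_preserving[OF tp] by (simp add: K_def)
    fix Ms assume "set Ms \<subseteq> \<M>"
    then show "good_outputs k (branches ?P dA dB (mixture dA dB Ms))"
      using n s by (simp add: a good_outputs_UN)
  qed
qed

section \<open>EPR states as multiples of the identity matrix\<close>

lemma nat_eq_if_low_bits_eq:
  assumes "x < 2 ^ n" "y < 2 ^ n" "\<And>q. q < n \<Longrightarrow> bit x q = bit (y::nat) q"
  shows "x = y"
proof -
  have "take_bit n x = take_bit n y"
    using assms(3) by (intro bit_eqI) (auto simp: bit_take_bit_iff)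
  then show ?thesis using assms by (simp add: take_bit_nat_eq_self)
qed

text \<open>If the two halves of the index differ, they differ in some bit, and the amplitude of
  that pair is a zero factor; otherwise all \<open>n\<close> factors are equal.\<close>

lemma epr_state_index:
  assumes "i < 2 ^ n * 2 ^ n"
  shows "epr_state n $ i = of_bool (i div 2 ^ n = i mod 2 ^ n) / complex_of_real (sqrt 2) ^ n"
proof -
  note l = pair_index_less[OF assms]
  show ?thesis
  proof (cases "i div 2 ^ n = i mod 2 ^ n")
    case True
    then show ?thesis using assms by (simp add: epr_state_def epr_amp_def power_one_over)
  next
    case False
    then obtain q where "q < n" "bit (i div 2 ^ n) q \<noteq> bit (i mod 2 ^ n) q"
      using nat_eq_if_low_bits_eq[OF l] by blast
    then have "(\<Prod>q<n. epr_amp (bit (i div 2 ^ n) q) (bit (i mod 2 ^ n) q)) = 0"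
      by (intro prod_zero) (auto simp: epr_amp_def)
    then show ?thesis using assms False by (simp add: epr_state_def)
  qed
qed

lemma ket_bra_epr_state:
  "ket_bra (epr_state n) = mixture (2 ^ n) (2 ^ n) [\<lambda>x y. of_bool (x = y) / complex_of_real (sqrt 2) ^ n]"
proof -
  have "dim_vec (epr_state n) = 2 ^ n * 2 ^ n" by (simp add: epr_state_def)
  then show ?thesis
    unfolding ket_bra_def mixture_def by (intro eq_matI) (auto simp: epr_state_index)
qed

text \<open>Components that are multiples of the identity all give the same density matrix up to a
  weight \<open>c M * cnj (c M)\<close>, and dividing by the trace removes the total weight
  \<open>w\<close>.\<close>

lemma purifiable_Output:
  assumes "k \<le> l"
    and "\<And>M. M \<in> \<M> \<Longrightarrow> \<exists>c. \<forall>x<2 ^ l. \<forall>y<2 ^ l. M x y = c * of_bool (x = y)"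
  shows "purifiable k (2 ^ l) (2 ^ l) \<M>"
proof -
  have "(1 / mtrace \<sigma>) \<cdot>\<^sub>m \<sigma> = ket_bra (epr_state l)"
    if Ms: "set Ms \<subseteq> \<M>" and \<sigma>: "\<sigma> = mixture (2 ^ l) (2 ^ l) Ms" and nz: "mtrace \<sigma> \<noteq> 0" for Ms \<sigma>
  proof -
    have "\<forall>M\<in>\<M>. \<exists>c. \<forall>x<2 ^ l. \<forall>y<2 ^ l. M x y = c * of_bool (x = y)"
      using assms by blast
    then obtain c where c: "\<And>M x y. M \<in> \<M> \<Longrightarrow> x < 2 ^ l \<Longrightarrow> y < 2 ^ l \<Longrightarrow> M x y = c M * of_bool (x = y)"
      by metis
    define w where "w = (\<Sum>M\<leftarrow>Ms. c M * cnj (c M))"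
    have e: "\<sigma> $$ (i, j) = w * of_bool (i div 2 ^ l = i mod 2 ^ l \<and> j div 2 ^ l = j mod 2 ^ l)"
      if "i < 2 ^ l * 2 ^ l" "j < 2 ^ l * 2 ^ l" for i j
    proof -
      have "\<sigma> $$ (i, j) = (\<Sum>M\<leftarrow>Ms. M (i div 2 ^ l) (i mod 2 ^ l) * cnj (M (j div 2 ^ l) (j mod 2 ^ l)))"
        using that by (simp add: \<sigma> mixture_def)
      also have "\<dots> = (\<Sum>M\<leftarrow>Ms. c M * cnj (c M) *
          of_bool (i div 2 ^ l = i mod 2 ^ l \<and> j div 2 ^ l = j mod 2 ^ l))"
        using Ms pair_index_less[OF that(1)] pair_index_less[OF that(2)]
        by (intro arg_cong[of _ _ sum_list] map_cong) (auto simp: c subset_iff)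
      finally show ?thesis by (simp add: w_def sum_list_mult_const)
    qed
    have d: "dim_row \<sigma> = 2 ^ l * 2 ^ l" "dim_col \<sigma> = 2 ^ l * 2 ^ l" by (simp_all add: \<sigma> mixture_def)
    \<comment> \<open>The diagonal entry is \<open>w\<close> at the \<open>2 ^ l\<close> joint
      indices with equal halves and zero elsewhere.\<close>
    have "mtrace \<sigma> = (\<Sum>i<2 ^ l * 2 ^ l. w * of_bool (i div (2::nat) ^ l = i mod 2 ^ l))"
      unfolding mtrace_def d by (intro sum.cong) (auto simp: e)
    also have "\<dots> = (\<Sum>x<(2::nat) ^ l. \<Sum>y<2 ^ l. if y = x then w else 0)"
      unfolding sum_lessThan_mult by (intro sum.cong) auto
    also have "\<dots> = 2 ^ l * w" by simp
    finally have t: "mtrace \<sigma> = 2 ^ l * w" .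
    have s: "complex_of_real (sqrt 2) ^ l * complex_of_real (sqrt 2) ^ l = 2 ^ l"
      by (metis of_real_mult of_real_numeral power_mult_distrib real_sqrt_mult_self abs_numeral)
    show ?thesis
      unfolding ket_bra_epr_state
      using nz by (intro eq_matI) (auto simp: e d t mixture_def s[symmetric] of_bool_def)
  qed
  then show ?thesis unfolding purifiable_def good_outputs_def
    using assms(1) by (intro exI[of _ "Output l"]) auto
qed

section \<open>Joint measurements and restriction to subspaces\<close>

text \<open>Both parties measure the same two-valued function \<open>h\<close> of their basis index:
  Alice's projector selects rows of the error matrix, Bob's selects columns.\<close>

lemma purifiable_measure_both:
  fixes h :: "nat \<Rightarrow> bool"
  assumes nxt: "\<And>\<alpha> \<beta>. purifiable k d d (\<N> \<alpha> \<beta>)"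
    and step: "\<And>\<alpha> \<beta> M M'. M \<in> \<M> \<Longrightarrow>
      (\<And>x y. x < d \<Longrightarrow> y < d \<Longrightarrow> M' x y = (if h x = \<alpha> \<and> h y = \<beta> then M x y else 0)) \<Longrightarrow> M' \<in> \<N> \<alpha> \<beta>"
  shows "purifiable k d d \<M>"
proof -
  \<comment> \<open>Outcome 1 stands for True and outcome 0 for False.\<close>
  define f where "f i a x = (of_bool (a = x \<and> h x = (i = 1)) :: complex)" for i a x :: nat
  have tp: "(\<Sum>i<2. \<Sum>a<d. cnj (f i a x) * f i a x') = of_bool (x = x')" if "x < d" "x' < d" for x x'
  proof -
    have "(\<Sum>a<d. cnj (f i a x) * f i a x') = (\<Sum>a<d. if a = x then of_bool (x = x' \<and> h x = (i = 1)) else 0)" for i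
      by (intro sum.cong refl) (auto simp: f_def)
    then show ?thesis using that by (simp add: numeral_2_eq_2)
  qed
  have left: "act_left d (mat d d (\<lambda>(a, x). f i a x)) M a y = (if h a = (i = 1) then M a y else 0)"
    if "a < d" for i a y M
  proof -
    have "act_left d (mat d d (\<lambda>(a, x). f i a x)) M a y = (\<Sum>x<d. if x = a then (if h a = (i = 1) then M a y else 0) else 0)"
      unfolding act_left_def using that by (intro sum.cong refl) (auto simp: f_def)
    then show ?thesis using that by simp
  qed
  have right: "act_right d (mat d d (\<lambda>(b, y). f i b y)) M x b = (if h b = (i = 1) then M x b else 0)"
    if "b < d" for i x b M
  proof -
    have "act_right d (mat d d (\<lambda>(b, y). f i b y)) M x b = (\<Sum>y<d. if y = b then (if h b = (i = 1) then M x b else 0) else 0)"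
      unfolding act_right_def using that by (intro sum.cong refl) (auto simp: f_def)
    then show ?thesis using that by simp
  qed
  \<comment> \<open>The matrices between the two measurements, with only Alice's rows
    selected.\<close>
  let ?L = "\<lambda>\<alpha>. {M'. \<exists>M\<in>\<M>. \<forall>x<d. \<forall>y<d. M' x y = (if h x = \<alpha> then M x y else 0)}"
  have L: "purifiable k d d (?L \<alpha>)" for \<alpha>
  proof (rule purifiable_Bob[OF tp, where \<N> = "\<lambda>i. \<N> \<alpha> (i = 1)"])
    show "purifiable k d d (\<N> \<alpha> (i = 1))" for i :: nat by (rule nxt)
    fix i :: nat and M' assume "M' \<in> ?L \<alpha>"
    then obtain M where "M \<in> \<M>" "\<forall>x<d. \<forall>y<d. M' x y = (if h x = \<alpha> then M x y else 0)" by blast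
    then show "act_right d (mat d d (\<lambda>(b, y). f i b y)) M' \<in> \<N> \<alpha> (i = 1)"
      by (intro step[of M]) (simp_all add: right)
  qed
  show ?thesis
  proof (rule purifiable_Alice[OF tp, where \<N> = "\<lambda>i. ?L (i = 1)"])
    show "purifiable k d d (?L (i = 1))" for i :: nat by (rule L)
    fix i :: nat and M assume "M \<in> \<M>"
    then show "act_left d (mat d d (\<lambda>(a, x). f i a x)) M \<in> ?L (i = 1)"
      by (intro CollectI bexI[of _ M]) (simp_all add: left)
  qed
qed

text \<open>Each party compresses its space to the span of the basis states enumerated by
  \<open>e\<close> or \<open>e'\<close>. By the support hypothesis the outcomes that merely complete
  the instruments yield the zero matrix, which \<open>zero\<close> places in the target set.\<close>

lemma purifiable_relabel:
  assumes d': "0 < d'"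
    and e: "inj_on e {..<d'}" "e ` {..<d'} \<subseteq> {..<d}"
    and e': "inj_on e' {..<d'}" "e' ` {..<d'} \<subseteq> {..<d}"
    and nxt: "purifiable k d' d' \<N>"
    and supp: "\<And>M x y. M \<in> \<M> \<Longrightarrow> x < d \<Longrightarrow> y < d \<Longrightarrow> x \<notin> e ` {..<d'} \<or> y \<notin> e' ` {..<d'} \<Longrightarrow> M x y = 0"
    and step: "\<And>M M'. M \<in> \<M> \<Longrightarrow> (\<And>a b. a < d' \<Longrightarrow> b < d' \<Longrightarrow> M' a b = M (e a) (e' b)) \<Longrightarrow> M' \<in> \<N>"
    and zero: "\<And>M'. (\<And>a b. a < d' \<Longrightarrow> b < d' \<Longrightarrow> M' a b = 0) \<Longrightarrow> M' \<in> \<N>"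
  shows "purifiable k d d \<M>"
proof -
  \<comment> \<open>Outcome 0 undoes \<open>e\<close>. Outcome \<open>Suc x\<close> sends a basis
    state \<open>x\<close> outside the range of \<open>e\<close> to the state 0, which exists
    because \<open>d'\<close> is positive.\<close>
  define f where "f e i a x = (if i = 0 then of_bool (x = e a)
      else of_bool (a = 0 \<and> Suc x = i \<and> x \<notin> e ` {..<d'}) :: complex)"
    for e :: "nat \<Rightarrow> nat" and i a x :: nat
  have tp: "(\<Sum>i<Suc d. \<Sum>a<d'. cnj (f e i a x) * f e i a x') = of_bool (x = x')"
    if "inj_on e {..<d'}" "x < d" "x' < d" for e x x'
  proof -
    have "(\<Sum>a<d'. cnj (f e 0 a x) * f e 0 a x') = of_bool (x = x' \<and> x \<in> e ` {..<d'})"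
    proof (cases "x = x' \<and> x \<in> e ` {..<d'}")
      case True
      then obtain c where c: "c < d'" "x = e c" "x' = e c" by auto
      then have "(\<Sum>a<d'. cnj (f e 0 a x) * f e 0 a x') = (\<Sum>a<d'. if a = c then 1 else 0)"
        using \<open>inj_on e {..<d'}\<close> by (intro sum.cong refl) (auto simp: f_def inj_on_def)
      then show ?thesis using True c by simp
    next
      case False
      then have "(\<Sum>a<d'. cnj (f e 0 a x) * f e 0 a x') = (\<Sum>a<d'. 0)"
        by (intro sum.cong refl) (auto simp: f_def)
      then show ?thesis using False by simp
    qed
    moreover have "(\<Sum>i<d. \<Sum>a<d'. cnj (f e (Suc i) a x) * f e (Suc i) a x') = of_bool (x = x' \<and> x \<notin> e ` {..<d'})"
    proof -
      have "(\<Sum>i<d. \<Sum>a<d'. cnj (f e (Suc i) a x) * f e (Suc i) a x') =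
          (\<Sum>i<d. \<Sum>a<d'. if a = 0 then (if i = x then of_bool (x = x' \<and> x \<notin> e ` {..<d'}) else 0) else 0)"
        by (intro sum.cong refl) (auto simp: f_def)
      then show ?thesis using that d' by simp
    qed
    ultimately show ?thesis by (subst sum.lessThan_Suc_shift) auto
  qed
  let ?A = "\<lambda>i. mat d' d (\<lambda>(a, x). f e i a x)" and ?B = "\<lambda>i. mat d' d (\<lambda>(b, y). f e' i b y)"
  have left: "act_left d (?A i) M a y = (if i = 0 then M (e a) y else 0)"
    if "a < d'" and s: "\<And>x. x < d \<Longrightarrow> x \<notin> e ` {..<d'} \<Longrightarrow> M x y = 0" for i a y M
  proof -
    have "act_left d (?A i) M a y = (\<Sum>x<d. if x = e a then (if i = 0 then M (e a) y else 0) else 0)"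
      unfolding act_left_def using that by (intro sum.cong refl) (auto simp: f_def)
    then show ?thesis using that e by auto
  qed
  have right: "act_right d (?B i) M x b = (if i = 0 then M x (e' b) else 0)"
    if "b < d'" and s: "\<And>y. y < d \<Longrightarrow> y \<notin> e' ` {..<d'} \<Longrightarrow> M x y = 0" for i x b M
  proof -
    have "act_right d (?B i) M x b = (\<Sum>y<d. if y = e' b then (if i = 0 then M x (e' b) else 0) else 0)"
      unfolding act_right_def using that by (intro sum.cong refl) (auto simp: f_def)
    then show ?thesis using that e' by auto
  qed
  \<comment> \<open>The second alternative covers Alice's outcomes other than 0.\<close>
  let ?L = "{M'. (\<exists>M\<in>\<M>. \<forall>a<d'. \<forall>y<d. M' a y = M (e a) y) \<or> (\<forall>a<d'. \<forall>y<d. M' a y = 0)}"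
  have L: "purifiable k d' d ?L"
  proof (rule purifiable_Bob[OF tp[OF e'(1)] nxt])
    fix i M' assume "M' \<in> ?L"
    then consider M where "M \<in> \<M>" "\<forall>a<d'. \<forall>y<d. M' a y = M (e a) y" | "\<forall>a<d'. \<forall>y<d. M' a y = 0" by blast
    then show "act_right d (?B i) M' \<in> \<N>"
    proof cases
      case 1
      have r: "act_right d (?B i) M' a b = (if i = 0 then M (e a) (e' b) else 0)" if "a < d'" "b < d'" for a b
      proof -
        have "M' a y = 0" if "y < d" "y \<notin> e' ` {..<d'}" for y
          using 1 supp[OF 1(1), of "e a" y] that \<open>a < d'\<close> e by auto
        then show ?thesis using right[of b M' a i] 1 that e' by auto
      qed
      then show ?thesis using step[OF 1(1)] zero by (cases "i = 0") auto
    next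
      case 2
      then have "act_right d (?B i) M' a b = 0" if "a < d'" "b < d'" for a b
        using right[of b M' a i] that e' by auto
      then show ?thesis by (rule zero)
    qed
  qed
  show ?thesis
  proof (rule purifiable_Alice[OF tp[OF e(1)] L])
    fix i M assume "M \<in> \<M>"
    then have "act_left d (?A i) M a y = (if i = 0 then M (e a) y else 0)" if "a < d'" "y < d" for a y
      using left supp that by simp
    then show "act_left d (?A i) M \<in> ?L" using \<open>M \<in> \<M>\<close> by (cases "i = 0") auto
  qed
qed

section \<open>Bit flips located by binary search\<close>

lemma less_two_power_if_bits:
  assumes "\<And>q. bit (x::nat) q \<Longrightarrow> q < n" shows "x < 2 ^ n"
proof -
  have "take_bit n x = x" using assms by (intro bit_eqI) (auto simp: bit_take_bit_iff)
  then show ?thesis by (metis take_bit_nat_less_exp)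
qed

lemma bit_less_if_less_two_power: "(x::nat) < 2 ^ n \<Longrightarrow> bit x q \<Longrightarrow> q < n"
  by (metis bit_take_bit_iff take_bit_nat_eq_self)

lemma xor_less_two_power:
  assumes "(x::nat) < 2 ^ n" "y < 2 ^ n" shows "xor x y < 2 ^ n"
  using assms by (intro less_two_power_if_bits) (auto simp: bit_xor_iff dest: bit_less_if_less_two_power)

lemma xor_xor_cancel_right: "xor (xor x z) z = (x::nat)"
  by (intro bit_eqI) (auto simp: bit_xor_iff)

lemma bit_two_power: "bit ((2::nat) ^ p) q \<longleftrightarrow> p = q"
  by (auto simp: bit_exp_iff)

text \<open>Separates an operator on qubit \<open>q\<close> into its diagonal part, spanned by I and
  Z, and its off-diagonal part, spanned by X and Y.\<close>

lemma agree_off_iff_flip: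
  assumes "x < 2 ^ n" "y < 2 ^ n"
  shows "(\<forall>p<n. p \<noteq> q \<longrightarrow> bit x p = bit (y::nat) p) \<longleftrightarrow> y = x \<or> y = xor x (2 ^ q)"
proof
  assume off: "\<forall>p<n. p \<noteq> q \<longrightarrow> bit x p = bit y p"
  have *: "bit x p = bit y p" if "p \<noteq> q" for p
    using off that assms bit_less_if_less_two_power by blast
  show "y = x \<or> y = xor x (2 ^ q)"
  proof (cases "bit x q = bit y q")
    case True
    then have "bit y p = bit x p" for p using * by (cases "p = q") auto
    then show ?thesis by (simp add: bit_eq_iff)
  next
    case False
    then have "bit y p = bit (xor x (2 ^ q)) p" for p
      using * by (cases "p = q") (auto simp: bit_xor_iff bit_two_power)
    then have "y = xor x (2 ^ q)" by (intro bit_eqI)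
    then show ?thesis ..
  qed
qed (auto simp: bit_xor_iff bit_two_power)

text \<open>The eigenvalue at the basis state \<open>x\<close> of the product of Z over the qubits
  in \<open>C\<close>. As a sign it is multiplicative under \<open>xor\<close>.\<close>

definition parity_sign :: "nat set \<Rightarrow> nat \<Rightarrow> int" where
  "parity_sign C x = (\<Prod>q\<in>C. if bit x q then -1 else 1)"

lemma parity_sign_cases: "parity_sign C x = 1 \<or> parity_sign C x = -1"
  unfolding parity_sign_def by (induction C rule: infinite_finite_induct) auto

lemma parity_sign_xor: "parity_sign C (xor x y) = parity_sign C x * parity_sign C y"
  unfolding parity_sign_def prod.distrib[symmetric] by (intro prod.cong) (auto simp: bit_xor_iff)

lemma parity_sign_two_power: "finite C \<Longrightarrow> parity_sign C (2 ^ q) = (if q \<in> C then -1 else 1)"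
  unfolding parity_sign_def by (simp add: bit_two_power)

lemma parity_sign_Un:
  "finite B \<Longrightarrow> finite C \<Longrightarrow> B \<inter> C = {} \<Longrightarrow> parity_sign (B \<union> C) x = parity_sign B x * parity_sign C x"
  unfolding parity_sign_def by (rule prod.union_disjoint)

text \<open>Translation by \<open>z\<close> is an involution of \<open>V\<close> that exchanges the
  two classes of \<open>h\<close>.\<close>

lemma card_half_if_xor_flips:
  assumes "finite V" and V: "\<And>x. x \<in> V \<Longrightarrow> xor x z \<in> V"
    and h: "\<And>x. x \<in> V \<Longrightarrow> h (xor x z) \<longleftrightarrow> \<not> h (x::nat)"
  shows "card V = 2 * card {x \<in> V. h x = \<alpha>}"
proof -
  have "bij_betw (\<lambda>x. xor x z) {x \<in> V. h x = \<alpha>} {x \<in> V. h x = (\<not> \<alpha>)}"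
    using V h by (intro bij_betw_byWitness[of _ "\<lambda>x. xor x z"]) (auto simp: xor_xor_cancel_right)
  then have "card {x \<in> V. h x = \<alpha>} = card {x \<in> V. h x = (\<not> \<alpha>)}" by (rule bij_betw_same_card)
  moreover have "card V = card {x \<in> V. h x = \<alpha>} + card {x \<in> V. h x = (\<not> \<alpha>)}"
    using assms(1) by (subst card_Un_disjoint[symmetric]) (auto intro: arg_cong[of _ _ card])
  ultimately show ?thesis by simp
qed

text \<open>Combinations of X and Y at one position of \<open>C\<close>: the coefficient depends on
  the flipped bit only. \<open>V\<close> holds the values of Alice's index compatible with her
  results, \<open>C\<close> the positions not yet excluded.\<close>

definition flip_errors :: "nat \<Rightarrow> nat set \<Rightarrow> nat set \<Rightarrow> (nat \<Rightarrow> nat \<Rightarrow> complex) set" where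
  "flip_errors n V C = {M. \<exists>q\<in>C. \<exists>g. \<forall>x<2 ^ n. \<forall>y<2 ^ n.
     M x y = (if x \<in> V \<and> y = xor x (2 ^ q) then g (bit x q) else 0)}"

text \<open>Bit \<open>q\<close> is constant on \<open>V\<close>, so the coefficient is the single
  number \<open>g c\<close> and X and Y need not be told apart. Bob corrects the flip by using the
  shifted enumeration \<open>e'\<close>.\<close>

lemma purifiable_located_flip:
  assumes V: "V \<subseteq> {..<2 ^ n}" "card V = 2 ^ l" "k \<le> l" and q: "q < n"
    and c: "\<And>x. x \<in> V \<Longrightarrow> bit x q = c"
  shows "purifiable k (2 ^ n) (2 ^ n) (flip_errors n V {q})"
proof -
  have "finite V" using V(1) finite_subset by blast
  then obtain e where e: "bij_betw e {..<(2::nat) ^ l} V"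
    using ex_bij_betw_nat_finite[of V] V(2) by (auto simp: atLeast0LessThan)
  define e' where "e' a = xor (e a) (2 ^ q)" for a
  have e'_inj: "e' a = e' b \<longleftrightarrow> e a = e b" for a b
    unfolding e'_def by (metis xor_xor_cancel_right)
  have inj: "e a = e b \<longleftrightarrow> a = b" if "a < 2 ^ l" "b < 2 ^ l" for a b
    using e that by (auto simp: bij_betw_def inj_on_def)
  have mem: "e a \<in> V" if "a < 2 ^ l" for a using e that by (auto simp: bij_betw_def)
  have less: "e a < 2 ^ n" "e' a < 2 ^ n" if "a < 2 ^ l" for a
    using mem[OF that] V(1) q by (auto simp: e'_def intro!: xor_less_two_power)
  show ?thesis
  proof (rule purifiable_relabel[of "2 ^ l" e _ e'])
    let ?N = "{M. \<exists>d. \<forall>x<2 ^ l. \<forall>y<2 ^ l. M x y = d * of_bool (x = y)} :: (nat \<Rightarrow> nat \<Rightarrow> complex) set"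
    show "purifiable k (2 ^ l) (2 ^ l) ?N" by (rule purifiable_Output[OF V(3)]) simp
    show "inj_on e {..<2 ^ l}" "inj_on e' {..<2 ^ l}" using inj by (auto simp: inj_on_def e'_inj)
    show "e ` {..<2 ^ l} \<subseteq> {..<2 ^ n}" "e' ` {..<2 ^ l} \<subseteq> {..<2 ^ n}" using less by auto
    show "M' \<in> ?N" if "\<And>a b. a < 2 ^ l \<Longrightarrow> b < 2 ^ l \<Longrightarrow> M' a b = 0" for M'
      using that by (auto intro: exI[of _ 0])
    fix M :: "nat \<Rightarrow> nat \<Rightarrow> complex" assume "M \<in> flip_errors n V {q}"
    then obtain g where M: "\<And>x y. x < 2 ^ n \<Longrightarrow> y < 2 ^ n \<Longrightarrow>
        M x y = (if x \<in> V \<and> y = xor x (2 ^ q) then g (bit x q) else 0)"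
      by (auto simp: flip_errors_def)
    have im: "x \<in> e ` {..<2 ^ l}" if "x \<in> V" for x using e that by (auto simp: bij_betw_def)
    show "M x y = 0" if "x < 2 ^ n" "y < 2 ^ n" "x \<notin> e ` {..<2 ^ l} \<or> y \<notin> e' ` {..<2 ^ l}" for x y
      using M[OF that(1,2)] that(3) im by (auto simp: e'_def image_iff)
    show "M' \<in> ?N" if "\<And>a b. a < 2 ^ l \<Longrightarrow> b < 2 ^ l \<Longrightarrow> M' a b = M (e a) (e' b)" for M'
    proof -
      have "M' a b = g c * of_bool (a = b)" if "a < 2 ^ l" "b < 2 ^ l" for a b
      proof -
        have "e' b = xor (e a) (2 ^ q) \<longleftrightarrow> b = a"
          using e'_inj[of b a] inj that by (simp add: e'_def)
        then show ?thesis
          using M[OF less(1)[OF that(1)] less(2)[OF that(2)]] mem[OF that(1)] c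
            \<open>\<And>a b. a < 2 ^ l \<Longrightarrow> b < 2 ^ l \<Longrightarrow> M' a b = M (e a) (e' b)\<close>[OF that] by auto
      qed
      then show ?thesis by blast
    qed
  qed simp
qed

text \<open>Induction on the number \<open>j\<close> of remaining search steps, each of which halves
  \<open>V\<close>. Invariance under double flips within \<open>C\<close> makes the halves equal;
  the constant parity on \<open>C\<close> becomes, once \<open>C\<close> is a singleton, the value
  of the flipped bit.\<close>

lemma purifiable_flip:
  assumes "V \<subseteq> {..<2 ^ n}" "C \<subseteq> {..<n}" "C \<noteq> {}" "card C \<le> 2 ^ j" "card V = 2 ^ l" "k + j \<le> l"
    and "\<And>x a b. x \<in> V \<Longrightarrow> a \<in> C \<Longrightarrow> b \<in> C \<Longrightarrow> xor x (xor (2 ^ a) (2 ^ b)) \<in> V"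
    and "\<And>x. x \<in> V \<Longrightarrow> parity_sign C x = c"
  shows "purifiable k (2 ^ n) (2 ^ n) (flip_errors n V C)"
  using assms
proof (induction j arbitrary: V C l c)
  case 0
  then have "card C = 1" by (metis One_nat_def card_gt_0_iff finite_lessThan finite_subset le_antisym less_eq_Suc_le power_0)
  then obtain q where C: "C = {q}" by (metis card_1_singletonE)
  have "bit x q = (c = -1)" if "x \<in> V" for x using "0.prems"(8)[OF that] by (auto simp: C parity_sign_def split: if_splits)
  then show ?case unfolding C using "0.prems" by (intro purifiable_located_flip[of V n l k q]) (auto simp: C)
next
  case (Suc j)
  have fin: "finite C" "finite V" using Suc.prems(1,2) finite_subset by blast+
  show ?case
  proof (cases "card C = 1")
    case True
    then show ?thesis using Suc.prems by (intro Suc.IH[of V C l c]) auto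
  next
    case False
    then have two: "2 \<le> card C" using fin Suc.prems(3) by (metis One_nat_def Suc_1 Suc_leI card_0_eq le_neq_implies_less less_one linorder_not_less)
    obtain B where B: "B \<subseteq> C" "card B = card C div 2"
      by (metis obtain_subset_with_card_n div_le_dividend)
    define D where "D = C - B"
    have cD: "card D = card C - card C div 2" using B fin by (simp add: D_def card_Diff_subset finite_subset)
    have ne: "B \<noteq> {}" "D \<noteq> {}" using two B(2) cD by auto
    have C: "C = B \<union> D" "B \<inter> D = {}" using B(1) by (auto simp: D_def)
    have finBD: "finite B" "finite D" using fin C by auto
    obtain p r where pr: "p \<in> B" "r \<in> D" using ne by blast
    define h where "h x \<longleftrightarrow> parity_sign B x = 1" for x
    have h_xor: "h (xor x y) = (h x = h y)" for x y
      using parity_sign_cases[of B x] parity_sign_cases[of B y] by (auto simp: h_def parity_sign_xor)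
    have h_exp: "h (2 ^ q) \<longleftrightarrow> q \<notin> B" for q using finBD by (simp add: h_def parity_sign_two_power)
    define W where "W \<alpha> = {x \<in> V. h x = \<alpha>}" for \<alpha>
    \<comment> \<open>The parities on \<open>B\<close> differ between the parties exactly if the
      flipped position lies in \<open>B\<close>.\<close>
    define E where "E \<alpha> \<beta> = (if \<alpha> = \<beta> then D else B)" for \<alpha> \<beta> :: bool
    \<comment> \<open>Flipping \<open>p\<close> in \<open>B\<close> together with \<open>r\<close>
      in \<open>D\<close> preserves \<open>V\<close> but changes the parity on
      \<open>B\<close>.\<close>
    have "card V = 2 * card (W \<alpha>)" for \<alpha>
      unfolding W_def using pr fin Suc.prems(7) C
      by (intro card_half_if_xor_flips[where z = "xor (2 ^ p) (2 ^ r)"]) (auto simp: h_xor h_exp)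
    then have cW: "card (W \<alpha>) = 2 ^ (l - 1)" for \<alpha>
      using Suc.prems(5,6) by (cases l) (auto simp: mult_left_cancel)
    show ?thesis
    proof (rule purifiable_measure_both[where h = h and \<N> = "\<lambda>\<alpha> \<beta>. flip_errors n (W \<alpha>) (E \<alpha> \<beta>)"])
      fix \<alpha> \<beta>
      \<comment> \<open>The parity on \<open>C\<close> is the product of those on \<open>B\<close>
        and \<open>D\<close>, so measuring it on \<open>B\<close> also fixes it on
        \<open>D\<close>.\<close>
      have sgn: "\<exists>c. \<forall>x\<in>W \<alpha>. parity_sign (E \<alpha> \<beta>) x = c"
      proof -
        have sB: "parity_sign B x = (if \<alpha> then 1 else -1)" if "x \<in> W \<alpha>" for x
          using that parity_sign_cases[of B x] by (auto simp: W_def h_def)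
        moreover have "parity_sign D x = c * (if \<alpha> then 1 else -1)" if "x \<in> W \<alpha>" for x
          using sB[OF that] Suc.prems(8)[of x] that parity_sign_Un[OF finBD C(2), of x]
          by (auto simp: W_def C(1)[symmetric])
        ultimately show ?thesis by (auto simp: E_def)
      qed
      then obtain c' where c': "\<And>x. x \<in> W \<alpha> \<Longrightarrow> parity_sign (E \<alpha> \<beta>) x = c'" by blast
      show "purifiable k (2 ^ n) (2 ^ n) (flip_errors n (W \<alpha>) (E \<alpha> \<beta>))"
      proof (rule Suc.IH[OF _ _ _ _ cW])
        show "W \<alpha> \<subseteq> {..<2 ^ n}" using Suc.prems(1) by (auto simp: W_def)
        show "E \<alpha> \<beta> \<subseteq> {..<n}" using Suc.prems(2) C by (auto simp: E_def)
        show "E \<alpha> \<beta> \<noteq> {}" using ne by (simp add: E_def)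
        show "card (E \<alpha> \<beta>) \<le> 2 ^ j" using Suc.prems(4) B(2) cD by (auto simp: E_def)
        show "k + j \<le> l - 1" using Suc.prems(6) by simp
        show "xor x (xor (2 ^ a) (2 ^ b)) \<in> W \<alpha>" if "x \<in> W \<alpha>" "a \<in> E \<alpha> \<beta>" "b \<in> E \<alpha> \<beta>" for x a b
          using that Suc.prems(7)[of x a b] C by (auto simp: W_def E_def h_xor h_exp split: if_splits)
      qed (rule c')
    next
      fix \<alpha> \<beta> and M M' :: "nat \<Rightarrow> nat \<Rightarrow> complex"
      assume "M \<in> flip_errors n V C"
        and M': "\<And>x y. x < 2 ^ n \<Longrightarrow> y < 2 ^ n \<Longrightarrow> M' x y = (if h x = \<alpha> \<and> h y = \<beta> then M x y else 0)"
      then obtain q g where q: "q \<in> C" and M: "\<And>x y. x < 2 ^ n \<Longrightarrow> y < 2 ^ n \<Longrightarrow>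
          M x y = (if x \<in> V \<and> y = xor x (2 ^ q) then g (bit x q) else 0)"
        by (auto simp: flip_errors_def)
      show "M' \<in> flip_errors n (W \<alpha>) (E \<alpha> \<beta>)"
      proof (cases "q \<in> E \<alpha> \<beta>")
        case True
        have "M' x y = (if x \<in> W \<alpha> \<and> y = xor x (2 ^ q) then g (bit x q) else 0)"
          if "x < 2 ^ n" "y < 2 ^ n" for x y
          using that True C by (auto simp: M M' W_def E_def h_xor h_exp split: if_splits)
        then show ?thesis using True unfolding flip_errors_def by blast
      next
        \<comment> \<open>The results contradict a flip at \<open>q\<close>, so the branch has the
          zero matrix, which counts as a flip with coefficient zero at any position.\<close>
        case False
        then have "M' x y = (if x \<in> W \<alpha> \<and> y = xor x (2 ^ q') then 0 else 0)"
          if "x < 2 ^ n" "y < 2 ^ n" for x y q'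
          using that q C by (auto simp: M M' W_def E_def h_xor h_exp split: if_splits)
        moreover obtain q' where "q' \<in> E \<alpha> \<beta>" using ne by (cases "\<alpha> = \<beta>") (auto simp: E_def)
        ultimately show ?thesis unfolding flip_errors_def by (intro CollectI bexI[of _ q'] exI[of _ "\<lambda>_. 0"]) auto
      qed
    qed
  qed
qed

section \<open>Phase errors located by the Hamming code\<close>

text \<open>The character \<open>(-1) ^ (s . u)\<close> of the group of \<open>m\<close>-bit words,
  where the dot is the inner product modulo 2.\<close>

definition char_sign :: "nat \<Rightarrow> nat \<Rightarrow> nat \<Rightarrow> int" where
  "char_sign m s u = (\<Prod>j<m. if bit s j \<and> bit u j then -1 else 1)"

lemma char_sign_commute: "char_sign m s u = char_sign m u s"
  unfolding char_sign_def by (intro prod.cong) auto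

lemma char_sign_xor: "char_sign m (xor s t) u = char_sign m s u * char_sign m t u"
  unfolding char_sign_def prod.distrib[symmetric] by (intro prod.cong) (auto simp: bit_xor_iff)

lemma char_sign_two_power: "j < m \<Longrightarrow> char_sign m (2 ^ j) u = (if bit u j then -1 else 1)"
proof -
  assume "j < m"
  have "char_sign m (2 ^ j) u = (\<Prod>i<m. if i = j then (if bit u j then -1 else 1) else 1)"
    unfolding char_sign_def by (intro prod.cong refl) (auto simp: bit_two_power)
  then show ?thesis using \<open>j < m\<close> by simp
qed

lemma char_sign_zero: "char_sign m 0 u = 1"
  by (simp add: char_sign_def)

lemma char_sign_cases: "char_sign m s u = 1 \<or> char_sign m s u = -1"
  unfolding char_sign_def by (induction m) auto

text \<open>If bit \<open>j\<close> of \<open>u\<close> is set, translating \<open>s\<close> by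
  \<open>2 ^ j\<close> negates the sum, which therefore vanishes.\<close>

lemma sum_char_sign:
  assumes "u < 2 ^ m"
  shows "(\<Sum>s<2 ^ m. char_sign m s u) = (if u = 0 then 2 ^ m else 0)"
proof (cases "u = 0")
  case True
  then show ?thesis by (simp add: char_sign_zero char_sign_commute[of _ _ 0])
next
  case False
  then obtain j where j: "bit u j" "j < m"
    using assms bit_less_if_less_two_power by (metis bit_0_eq bit_eqI bot_apply bot_bool_def)
  have "(\<Sum>s<2 ^ m. char_sign m s u) = (\<Sum>s<2 ^ m. char_sign m (xor s (2 ^ j)) u)"
    using j by (intro sum.reindex_bij_witness[of _ "\<lambda>s. xor s (2 ^ j)" "\<lambda>s. xor s (2 ^ j)"])
      (auto simp: xor_xor_cancel_right intro!: xor_less_two_power)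
  also have "\<dots> = - (\<Sum>s<2 ^ m. char_sign m s u)"
    using j by (simp add: char_sign_xor char_sign_two_power sum_negf)
  finally show ?thesis using False by simp
qed

lemma xor_eq_zero_iff: "xor x y = 0 \<longleftrightarrow> x = (y::nat)"
  by (metis xor_self_eq xor_xor_cancel_right xor.left_neutral)

lemma sum_char_sign_mult:
  assumes "s < 2 ^ m" "t < 2 ^ m"
  shows "(\<Sum>u<2 ^ m. char_sign m s u * char_sign m t u) = (if s = t then 2 ^ m else 0)"
  using sum_char_sign[of "xor s t" m] xor_less_two_power[OF assms]
  by (simp add: char_sign_xor[symmetric] char_sign_commute[of m _ "xor s t"] xor_eq_zero_iff)

text \<open>A nontrivial character is -1 on exactly half of the \<open>2 ^ m\<close> words, and this
  half is even for \<open>2 \<le> m\<close>. It is the source of the even weights of the simplex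
  code.\<close>

lemma prod_char_sign:
  assumes "2 \<le> m" "u < 2 ^ m"
  shows "(\<Prod>s<2 ^ m. char_sign m s u) = 1"
proof (cases "u = 0")
  case True
  then show ?thesis by (simp add: char_sign_zero char_sign_commute[of _ _ 0])
next
  case False
  let ?N = "{s \<in> {..<2 ^ m}. char_sign m s u = -1}"
  have "(\<Sum>s<2 ^ m. char_sign m s u) = (\<Sum>s<2 ^ m. 1 - 2 * of_bool (char_sign m s u = -1))"
    using char_sign_cases by (intro sum.cong refl) fastforce
  also have "\<dots> = 2 ^ m - 2 * int (card ?N)"
    by (simp add: sum_subtractf sum_distrib_left[symmetric] Int_def)
  finally have "2 * int (card ?N) = 2 ^ m" using sum_char_sign[OF assms(2)] False by simp
  also have "(2::int) ^ m = 2 * (2 * 2 ^ (m - 2))"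
    using assms(1) by (metis le_add_diff_inverse power_add power2_eq_square mult.assoc)
  finally have "even (card ?N)" by presburger
  moreover have "(\<Prod>s<2 ^ m. char_sign m s u) = (\<Prod>s<2 ^ m. if s \<in> ?N then -1 else 1)"
    using char_sign_cases by (intro prod.cong refl) fastforce
  moreover have "\<dots> = (-1) ^ card ?N" by (subst prod.inter_restrict[symmetric]) (auto simp: Int_def)
  ultimately show ?thesis by simp
qed

text \<open>The simplex code: bit \<open>q\<close> is the inner product of \<open>u\<close> with
  \<open>q + 1\<close>, the column of the Hamming check matrix at position \<open>q\<close>. The
  shift by one omits the zero column.\<close>

definition codeword :: "nat \<Rightarrow> nat \<Rightarrow> nat" where
  "codeword m u = horner_sum of_bool 2 (map (\<lambda>q. char_sign m (Suc q) u = -1) [0..<2 ^ m - 1])"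

lemma bit_codeword: "bit (codeword m u) q \<longleftrightarrow> q < 2 ^ m - 1 \<and> char_sign m (Suc q) u = -1"
  unfolding codeword_def by (auto simp: bit_horner_sum_bit_iff)

lemma codeword_less: "codeword m u < 2 ^ (2 ^ m - 1)"
  by (intro less_two_power_if_bits) (simp add: bit_codeword)

text \<open>The omitted zero column would contribute a factor 1, so the parity equals the product
  over all words.\<close>

lemma parity_sign_codeword:
  assumes "2 \<le> m" "u < 2 ^ m"
  shows "parity_sign {..<2 ^ m - 1} (codeword m u) = 1"
proof -
  have "parity_sign {..<2 ^ m - 1} (codeword m u) = (\<Prod>q<2 ^ m - 1. char_sign m (Suc q) u)"
    unfolding parity_sign_def using char_sign_cases by (intro prod.cong refl) (fastforce simp: bit_codeword)
  also have "\<dots> = (\<Prod>q<Suc (2 ^ m - 1). char_sign m q u)"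
    unfolding prod.lessThan_Suc_shift by (simp add: char_sign_zero)
  also have "\<dots> = 1" using prod_char_sign[OF assms] by simp
  finally show ?thesis .
qed

lemma bit_codeword_two_power:
  assumes "j < m" shows "bit (codeword m u) (2 ^ j - Suc 0) \<longleftrightarrow> bit u j"
proof -
  have "(2::nat) ^ j < 2 ^ m" using assms by simp
  then have "(2::nat) ^ j - 1 < 2 ^ m - 1" by (simp add: diff_less_mono)
  then show ?thesis using assms by (simp add: bit_codeword char_sign_two_power)
qed

text \<open>The cosets of the simplex code, the row space of the Hamming parity checks, have unique
  representatives vanishing at the positions \<open>2 ^ j - 1\<close>, whose check columns are the unit vectors.\<close>

lemma codeword_coset_decomposition:
  assumes m: "2 \<le> m" and n: "n = 2 ^ m - 1" and V: "V = {x. x < 2 ^ n \<and> parity_sign {..<n} x = c}"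
  defines "R \<equiv> {x \<in> V. \<forall>j<m. \<not> bit x (2 ^ j - 1)}"
  shows "bij_betw (\<lambda>(x, u). xor x (codeword m u)) (R \<times> {..<2 ^ m}) V"
proof -
  \<comment> \<open>Reads \<open>u\<close> off an element of the coset: at the positions
    \<open>2 ^ j - 1\<close> the representative is zero and the codeword shows the bits of
    \<open>u\<close>.\<close>
  define h :: "nat \<Rightarrow> nat" where "h x = horner_sum of_bool 2 (map (\<lambda>j. bit x (2 ^ j - 1)) [0..<m])" for x
  have h_bit: "bit (h x) j \<longleftrightarrow> j < m \<and> bit x (2 ^ j - 1)" for x j
    unfolding h_def by (auto simp: bit_horner_sum_bit_iff)
  have h_less: "h x < 2 ^ m" for x by (intro less_two_power_if_bits) (simp add: h_bit)
  have V_xor: "xor x (codeword m u) \<in> V" if "x \<in> V" "u < 2 ^ m" for x u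
    using that m codeword_less[of m u] parity_sign_codeword[of m u]
    by (auto simp: V n parity_sign_xor intro!: xor_less_two_power)
  have inv: "h (xor x (codeword m u)) = u" if "x \<in> R" "u < 2 ^ m" for x u
    using that by (intro bit_eqI)
      (auto simp: h_bit bit_xor_iff bit_codeword_two_power R_def dest: bit_less_if_less_two_power)
  show ?thesis
    by (intro bij_betw_byWitness[of _ "\<lambda>y. (xor y (codeword m (h y)), h y)"])
      (auto simp: inv xor_xor_cancel_right h_less R_def V_xor h_bit bit_xor_iff bit_codeword_two_power)
qed

text \<open>An index combines a coset number \<open>i div 2 ^ m\<close> with a codeword label
  \<open>i mod 2 ^ m\<close>. As a function of the label, a phase error at \<open>q\<close> is a
  combination of the trivial character and the character of \<open>q + 1\<close>. Measuring the
  labels in the basis of characters, with results \<open>s\<close> and \<open>t\<close>, leaves a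
  nonzero amplitude only if \<open>xor s t\<close> is 0 or \<open>q + 1\<close>.\<close>

lemma purifiable_Fourier:
  fixes \<rho> :: "nat \<Rightarrow> nat \<Rightarrow> bool"
  assumes D_def: "D = 2 ^ k * 2 ^ m"
    and \<M>_def: "\<M> = {M. \<exists>q<2 ^ m - 1. \<exists>g. \<forall>i<D. \<forall>i'<D. M i i' =
    (if i = i' then g (\<rho> (i div 2 ^ m) q \<noteq> (char_sign m (Suc q) (i mod 2 ^ m) = -1)) else (0::complex))}"
  shows "purifiable k D D \<M>"
proof -
  define w where "w = complex_of_real (sqrt 2) ^ m"
  have "complex_of_real (sqrt 2) * complex_of_real (sqrt 2) = 2"
    by (metis of_real_mult of_real_numeral real_sqrt_mult_self abs_numeral)
  then have ww: "w * w = 2 ^ m" by (simp add: w_def power_mult_distrib[symmetric])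
  have w0: "w \<noteq> 0" by (simp add: w_def)
  have cw: "cnj w = w" by (simp add: w_def)
  define \<chi> where "\<chi> s u = complex_of_int (char_sign m s u)" for s u
  have \<chi>_sum: "(\<Sum>u<2 ^ m. \<chi> s u * \<chi> t u) = (if s = t then 2 ^ m else 0)" if "s < 2 ^ m" "t < 2 ^ m" for s t
  proof -
    have "(\<Sum>u<2 ^ m. \<chi> s u * \<chi> t u) = complex_of_int (\<Sum>u<2 ^ m. char_sign m s u * char_sign m t u)"
      by (simp add: \<chi>_def)
    then show ?thesis by (simp add: sum_char_sign_mult[OF that])
  qed
  have \<chi>_comm: "\<chi> s u = \<chi> u s" for s u by (simp add: \<chi>_def char_sign_commute)
  have \<chi>_xor: "\<chi> (xor s t) u = \<chi> s u * \<chi> t u" for s t u by (simp add: \<chi>_def char_sign_xor)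
  \<comment> \<open>Syndromes with \<open>xor s t = q + 1\<close> reveal a phase flip at \<open>q\<close>; \<open>\<epsilon>\<close> is Bob's correction.\<close>
  define \<epsilon> where "\<epsilon> s t b = (if s \<noteq> t \<and> \<rho> b (xor s t - 1) then -1 else 1 :: complex)" for s t b
  \<comment> \<open>Contraction of the label with the normalized character of the outcome
    \<open>i\<close>; the sign \<open>\<eta>\<close> is 1 for Alice and \<open>\<epsilon> s\<close>
    for Bob.\<close>
  define f where "f \<eta> i a x = (if x div 2 ^ m = a then \<eta> i a * \<chi> i (x mod 2 ^ m) / w else 0)"
    for \<eta> :: "nat \<Rightarrow> nat \<Rightarrow> complex" and i a x :: nat
  have tp: "(\<Sum>i<2 ^ m. \<Sum>a<2 ^ k. cnj (f \<eta> i a x) * f \<eta> i a x') = of_bool (x = x')"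
    if \<eta>: "\<And>i a. \<eta> i a = 1 \<or> \<eta> i a = -1" and x: "x < D" "x' < D" for \<eta> x x'
  proof -
    have xx: "x div 2 ^ m < 2 ^ k" using x pair_index_less unfolding D_def by blast
    have c: "cnj (\<chi> s u) = \<chi> s u" for s u by (simp add: \<chi>_def)
    have "(\<Sum>a<2 ^ k. cnj (f \<eta> i a x) * f \<eta> i a x') =
        (\<Sum>a<2 ^ k. if a = x div 2 ^ m then (if x div 2 ^ m = x' div 2 ^ m then
          \<chi> (x mod 2 ^ m) i * \<chi> (x' mod 2 ^ m) i / 2 ^ m else 0) else 0)" for i
    proof (intro sum.cong refl)
      fix a
      show "cnj (f \<eta> i a x) * f \<eta> i a x' = (if a = x div 2 ^ m then (if x div 2 ^ m = x' div 2 ^ m then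
          \<chi> (x mod 2 ^ m) i * \<chi> (x' mod 2 ^ m) i / 2 ^ m else 0) else 0)"
        using \<eta>[of i a] by (auto simp: f_def c cw ww \<chi>_comm[of i])
    qed
    then have "(\<Sum>i<2 ^ m. \<Sum>a<2 ^ k. cnj (f \<eta> i a x) * f \<eta> i a x') =
        (\<Sum>i<2 ^ m. if x div 2 ^ m = x' div 2 ^ m then \<chi> (x mod 2 ^ m) i * \<chi> (x' mod 2 ^ m) i / 2 ^ m else 0)"
      using xx by simp
    also have "\<dots> = (if x div 2 ^ m = x' div 2 ^ m \<and> x mod 2 ^ m = x' mod 2 ^ m then 1 else 0)"
      by (cases "x div 2 ^ m = x' div 2 ^ m") (auto simp: sum_divide_distrib[symmetric] \<chi>_sum)
    also have "\<dots> = of_bool (x = x')"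
    proof -
      have "x = x'" if "x div 2 ^ m = x' div 2 ^ m" "x mod 2 ^ m = x' mod 2 ^ m"
        using that by (metis div_mult_mod_eq)
      then show ?thesis by auto
    qed
    finally show ?thesis .
  qed
  \<comment> \<open>After Alice's result \<open>s\<close> her index is a coset number, while Bob's
    still includes the label; the diagonal matrix passes her character on to him.\<close>
  let ?L = "\<lambda>s. {M. \<exists>q<2 ^ m - 1. \<exists>g. \<forall>a<2 ^ k. \<forall>y<D. M a y =
    (if y div 2 ^ m = a then \<chi> s (y mod 2 ^ m) / w * g (\<rho> a q \<noteq> (char_sign m (Suc q) (y mod 2 ^ m) = -1)) else (0::complex))}"
  let ?N = "{M. \<exists>c. \<forall>x<2 ^ k. \<forall>y<2 ^ k. M x y = c * of_bool (x = y)} :: (nat \<Rightarrow> nat \<Rightarrow> complex) set"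
  have N: "purifiable k (2 ^ k) (2 ^ k) ?N" by (rule purifiable_Output) simp_all
  have L: "purifiable k (2 ^ k) D (?L s)" if s: "s < 2 ^ m" for s
  proof (rule purifiable_Bob[OF tp N])
    show "\<epsilon> s t b = 1 \<or> \<epsilon> s t b = -1" for t b by (simp add: \<epsilon>_def)
    fix t :: nat and M assume t: "t < 2 ^ m" and "M \<in> ?L s"
    then obtain q g where q: "q < 2 ^ m - 1" and M: "\<And>a y. a < 2 ^ k \<Longrightarrow> y < D \<Longrightarrow> M a y =
      (if y div 2 ^ m = a then \<chi> s (y mod 2 ^ m) / w * g (\<rho> a q \<noteq> (char_sign m (Suc q) (y mod 2 ^ m) = -1)) else 0)"
      by blast
    \<comment> \<open>The coefficients of I and Z: \<open>g False = A + B\<close> and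
      \<open>g True = A - B\<close>.\<close>
    define A B where "A = (g False + g True) / 2" and "B = (g False - g True) / 2"
    have g: "g (\<rho> a q \<noteq> (char_sign m (Suc q) u = -1)) = A + B * (if \<rho> a q then -1 else 1) * \<chi> (Suc q) u" for a u
      using char_sign_cases[of m "Suc q" u] by (auto simp: \<chi>_def A_def B_def field_simps)
    have split: "(\<Sum>u<2 ^ m. p * (\<chi> s u * \<chi> t u) * (A + z * \<chi> (Suc q) u)) =
        p * (A * (\<Sum>u<2 ^ m. \<chi> s u * \<chi> t u) + z * (\<Sum>u<2 ^ m. \<chi> (xor s t) u * \<chi> (Suc q) u))" for p z
    proof -
      have "(\<Sum>u<2 ^ m. p * (\<chi> s u * \<chi> t u) * (A + z * \<chi> (Suc q) u)) =
          (\<Sum>u<2 ^ m. p * A * (\<chi> s u * \<chi> t u) + p * z * (\<chi> (xor s t) u * \<chi> (Suc q) u))"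
        by (intro sum.cong refl) (simp add: \<chi>_xor algebra_simps)
      then show ?thesis by (simp only: sum.distrib sum_distrib_left[symmetric] distrib_left mult.assoc)
    qed
    \<comment> \<open>The factor of the identity: equal results select I, the syndrome of
      \<open>q\<close> selects Z, and any other result has amplitude zero.\<close>
    define c where "c = (if s = t then A else if xor s t = Suc q then B else 0)"
    let ?B = "mat (2 ^ k) D (\<lambda>(b, y). f (\<epsilon> s) t b y)"
    have "act_right D ?B M a b = c * of_bool (a = b)" if ab: "a < 2 ^ k" "b < 2 ^ k" for a b
    proof -
      have "act_right D ?B M a b = (\<Sum>x<2 ^ k. \<Sum>u<2 ^ m. ?B $$ (b, x * 2 ^ m + u) * M a (x * 2 ^ m + u))"
        by (simp add: act_right_def D_def sum_lessThan_mult)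
      also have "\<dots> = (\<Sum>x<2 ^ k. if x = a then (\<Sum>u<2 ^ m. if a = b then
           \<epsilon> s t a / 2 ^ m * (\<chi> s u * \<chi> t u) * (A + B * (if \<rho> a q then -1 else 1) * \<chi> (Suc q) u) else 0) else 0)"
      proof (intro sum.cong refl)
        fix x assume "x \<in> {..<(2::nat) ^ k}"
        then have x: "x < 2 ^ k" by simp
        have "?B $$ (b, x * 2 ^ m + u) * M a (x * 2 ^ m + u) = (if x = a then if a = b then
           \<epsilon> s t a / 2 ^ m * (\<chi> s u * \<chi> t u) * (A + B * (if \<rho> a q then -1 else 1) * \<chi> (Suc q) u) else 0 else 0)"
          if u: "u < 2 ^ m" for u
        proof -
          have less: "x * 2 ^ m + u < D" unfolding D_def using x u by (rule pair_index_bound)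
          have dm: "(x * 2 ^ m + u) div 2 ^ m = x" "(x * 2 ^ m + u) mod 2 ^ m = u" using u by simp_all
          show ?thesis unfolding M[OF ab(1) less] dm g
            using ab less u by (simp add: f_def dm ww[symmetric])
        qed
        then show "(\<Sum>u<2 ^ m. ?B $$ (b, x * 2 ^ m + u) * M a (x * 2 ^ m + u)) =
          (if x = a then (\<Sum>u<2 ^ m. if a = b then
           \<epsilon> s t a / 2 ^ m * (\<chi> s u * \<chi> t u) * (A + B * (if \<rho> a q then -1 else 1) * \<chi> (Suc q) u) else 0) else 0)"
          by simp
      qed
      also have "\<dots> = (\<Sum>u<2 ^ m. if a = b then
           \<epsilon> s t a / 2 ^ m * (\<chi> s u * \<chi> t u) * (A + B * (if \<rho> a q then -1 else 1) * \<chi> (Suc q) u) else 0)"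
        using ab by simp
      also have "\<dots> = (if a = b then \<epsilon> s t a / 2 ^ m * (A * (\<Sum>u<2 ^ m. \<chi> s u * \<chi> t u) +
          B * (if \<rho> a q then -1 else 1) * (\<Sum>u<2 ^ m. \<chi> (xor s t) u * \<chi> (Suc q) u)) else 0)"
        unfolding split[symmetric] by (cases "a = b") simp_all
      also have "\<dots> = c * of_bool (a = b)"
      proof -
        \<comment> \<open>Orthogonality leaves one term. If it is the Z term, then
          \<open>xor s t - 1 = q\<close>, and \<open>\<epsilon>\<close> cancels the sign coming from
          \<open>\<rho> a q\<close>.\<close>
        have "(\<Sum>u<2 ^ m. \<chi> (xor s t) u * \<chi> (Suc q) u) = (if xor s t = Suc q then 2 ^ m else 0)"
          using q by (intro \<chi>_sum xor_less_two_power s t) simp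
        moreover have "xor s t = 0" if "s = t" using that by (simp add: xor_eq_zero_iff)
        ultimately show ?thesis using \<chi>_sum[OF s t] xor_eq_zero_iff[of s t]
          by (auto simp: c_def \<epsilon>_def)
      qed
      finally show ?thesis .
    qed
    then show "act_right D ?B M \<in> ?N" by blast
  qed
  show ?thesis
  proof (rule purifiable_Alice[where \<N> = ?L])
    show "(\<Sum>i<2 ^ m. \<Sum>a<2 ^ k. cnj (f (\<lambda>_ _. 1) i a x) * f (\<lambda>_ _. 1) i a x') = of_bool (x = x')"
      if "x < D" "x' < D" for x x'
      using that by (intro tp) simp_all
    fix s :: nat and M assume "M \<in> \<M>"
    then obtain q g where q: "q < 2 ^ m - 1" and M: "\<And>i i'. i < D \<Longrightarrow> i' < D \<Longrightarrow> M i i' =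
      (if i = i' then g (\<rho> (i div 2 ^ m) q \<noteq> (char_sign m (Suc q) (i mod 2 ^ m) = -1)) else 0)"
      unfolding \<M>_def by blast
    let ?A = "mat (2 ^ k) D (\<lambda>(a, x). f (\<lambda>_ _. 1) s a x)"
    have "act_left D ?A M a y = (if y div 2 ^ m = a then \<chi> s (y mod 2 ^ m) / w *
        g (\<rho> a q \<noteq> (char_sign m (Suc q) (y mod 2 ^ m) = -1)) else 0)" if "a < 2 ^ k" "y < D" for a y
    proof -
      have "act_left D ?A M a y = (\<Sum>x<D. if x = y then (if y div 2 ^ m = a then \<chi> s (y mod 2 ^ m) / w *
        g (\<rho> a q \<noteq> (char_sign m (Suc q) (y mod 2 ^ m) = -1)) else 0) else 0)"
        unfolding act_left_def using that by (intro sum.cong refl) (simp add: M f_def)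
      then show ?thesis using that by simp
    qed
    then show "act_left D ?A M \<in> ?L s" using q by blast
  qed (rule L)
qed

lemma card_parity_class:
  assumes "0 < n" shows "card {x. x < 2 ^ n \<and> (parity_sign {..<n} x = 1) = \<alpha>} = 2 ^ (n - 1)"
proof -
  have "card {..<(2::nat) ^ n} = 2 * card {x \<in> {..<2 ^ n}. (parity_sign {..<n} x = 1) = \<alpha>}"
  proof (rule card_half_if_xor_flips[where z = "2 ^ 0"])
    show "xor x (2 ^ 0) \<in> {..<2 ^ n}" if "x \<in> {..<2 ^ n}" for x :: nat
      using that one_less_power[OF _ assms, of "2::nat"] by (auto intro!: xor_less_two_power)
    show "(parity_sign {..<n} (xor x (2 ^ 0)) = 1) = (parity_sign {..<n} x \<noteq> 1)" for x
      using assms parity_sign_cases[of "{..<n}" x] parity_sign_two_power[of "{..<n}" 0]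
      by (auto simp: parity_sign_xor)
  qed simp
  then show ?thesis using assms by (cases n) auto
qed

text \<open>Combinations of I and Z at one position, restricted to a parity class
  \<open>V\<close>.\<close>

definition phase_errors :: "nat \<Rightarrow> nat set \<Rightarrow> (nat \<Rightarrow> nat \<Rightarrow> complex) set" where
  "phase_errors n V = {M. \<exists>q<n. \<exists>g. \<forall>x<2 ^ n. \<forall>y<2 ^ n.
     M x y = (if x \<in> V \<and> y = x then g (bit x q) else 0)}"

text \<open>Makes the truncated subtraction in \<open>2 ^ m - m - 2\<close> exact.\<close>

lemma Suc_le_two_power: "2 \<le> m \<Longrightarrow> m + 2 \<le> 2 ^ m"
  by (induction m rule: dec_induct) auto

text \<open>Enumerating \<open>V\<close> by coset representative and codeword label turns bit
  \<open>q\<close> into the bit of the representative plus a character value, the form treated by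
  \<open>purifiable_Fourier\<close>.\<close>

lemma purifiable_phase:
  assumes m: "2 \<le> m" and n: "n = 2 ^ m - 1" and V: "V = {x. x < 2 ^ n \<and> (parity_sign {..<n} x = 1) = \<alpha>}"
  shows "purifiable (2 ^ m - m - 2) (2 ^ n) (2 ^ n) (phase_errors n V)"
proof -
  define k where "k = 2 ^ m - m - 2"
  have kn: "k + m = n - 1" "0 < n" using Suc_le_two_power[OF m] by (auto simp: k_def n)
  define R where "R = {x \<in> V. \<forall>j<m. \<not> bit x (2 ^ j - 1)}"
  have "(parity_sign {..<n} x = 1) = \<alpha> \<longleftrightarrow> parity_sign {..<n} x = (if \<alpha> then 1 else -1)" for x
    using parity_sign_cases[of "{..<n}" x] by auto
  then have "V = {x. x < 2 ^ n \<and> parity_sign {..<n} x = (if \<alpha> then 1 else -1)}" unfolding V by blast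
  then have bij: "bij_betw (\<lambda>(x, u). xor x (codeword m u)) (R \<times> {..<2 ^ m}) V"
    unfolding R_def by (rule codeword_coset_decomposition[OF m n])
  have finR: "finite R" by (rule finite_subset[of _ "{..<2 ^ n}"]) (auto simp: R_def V)
  \<comment> \<open>\<open>V\<close> has \<open>2 ^ (n - 1)\<close> elements and every coset has
    \<open>2 ^ m\<close>.\<close>
  have "card R * 2 ^ m = 2 ^ (k + m)"
    unfolding kn(1) using bij_betw_same_card[OF bij] card_parity_class[OF kn(2), of \<alpha>] by (simp add: card_cartesian_product V)
  then have "card R = 2 ^ k" by (simp add: power_add)
  then obtain r where r: "bij_betw r {..<(2::nat) ^ k} R"
    using ex_bij_betw_nat_finite[OF finR] by (auto simp: atLeast0LessThan)
  define D :: nat where "D = 2 ^ k * 2 ^ m"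
  define e where "e i = xor (r (i div 2 ^ m)) (codeword m (i mod 2 ^ m))" for i
  have e: "bij_betw e {..<D} V"
  proof -
    have "bij_betw (\<lambda>i. (i div 2 ^ m, i mod 2 ^ m)) {..<D} ({..<2 ^ k} \<times> {..<2 ^ m})"
      unfolding D_def by (intro bij_betw_byWitness[of _ "\<lambda>(x, y). x * 2 ^ m + y"])
        (auto dest: pair_index_less intro!: pair_index_bound intro: div_mult_mod_eq)
    moreover have "bij_betw (\<lambda>(a, u). (r a, u)) ({..<2 ^ k} \<times> {..<2 ^ m}) (R \<times> {..<2 ^ m})"
      using r by (auto simp: bij_betw_def inj_on_def image_iff)
    ultimately have "bij_betw ((\<lambda>(x, u). xor x (codeword m u)) \<circ> (\<lambda>(a, u). (r a, u)) \<circ> (\<lambda>i. (i div 2 ^ m, i mod 2 ^ m))) {..<D} V"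
      using bij by (blast intro: bij_betw_trans)
    then show ?thesis by (simp add: comp_def e_def[abs_def])
  qed
  have im: "e ` {..<D} = V" and inj: "inj_on e {..<D}" using e by (auto simp: bij_betw_def)
  have sub: "e ` {..<D} \<subseteq> {..<2 ^ n}" unfolding im V by auto
  let ?N = "{M. \<exists>q<2 ^ m - 1. \<exists>g. \<forall>i<D. \<forall>i'<D. M i i' =
    (if i = i' then g (bit (r (i div 2 ^ m)) q \<noteq> (char_sign m (Suc q) (i mod 2 ^ m) = -1)) else (0::complex))}"
  have "purifiable k (2 ^ n) (2 ^ n) (phase_errors n V)"
  proof (rule purifiable_relabel[OF _ inj sub inj sub])
    show "0 < D" by (simp add: D_def)
    show "purifiable k D D ?N" by (rule purifiable_Fourier[OF D_def refl])
    \<comment> \<open>The zero matrix counts as a phase error at position 0 with coefficient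
      zero.\<close>
    show "M' \<in> ?N" if "\<And>a b. a < D \<Longrightarrow> b < D \<Longrightarrow> M' a b = 0" for M'
      using that kn n by (auto intro!: exI[of _ 0] exI[of _ "\<lambda>_. 0"])
    fix M assume "M \<in> phase_errors n V"
    then obtain q g where q: "q < n" and M: "\<And>x y. x < 2 ^ n \<Longrightarrow> y < 2 ^ n \<Longrightarrow>
        M x y = (if x \<in> V \<and> y = x then g (bit x q) else 0)"
      unfolding phase_errors_def by blast
    show "M x y = 0" if "x < 2 ^ n" "y < 2 ^ n" "x \<notin> e ` {..<D} \<or> y \<notin> e ` {..<D}" for x y
      using that M unfolding im by auto
    fix M' assume M': "\<And>a b. a < D \<Longrightarrow> b < D \<Longrightarrow> M' a b = M (e a) (e b)"
    have "M' a b = (if a = b then g (bit (r (a div 2 ^ m)) q \<noteq> (char_sign m (Suc q) (a mod 2 ^ m) = -1)) else 0)"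
      if ab: "a < D" "b < D" for a b
    proof -
      have V: "e a \<in> V" "e b \<in> V" using ab im by auto
      then have less: "e a < 2 ^ n" "e b < 2 ^ n" using sub im by auto
      have eq: "e b = e a \<longleftrightarrow> b = a" using ab inj by (auto simp: inj_on_def)
      have bit: "bit (e a) q \<longleftrightarrow> bit (r (a div 2 ^ m)) q \<noteq> (char_sign m (Suc q) (a mod 2 ^ m) = -1)"
        using q by (simp add: e_def bit_xor_iff bit_codeword n)
      show ?thesis unfolding M'[OF ab] M[OF less] eq bit using V by auto
    qed
    then show "M' \<in> ?N" using q unfolding n by blast
  qed
  then show ?thesis by (simp add: k_def)
qed

section \<open>Arbitrary errors on one qubit and the complete protocol\<close>

text \<open>\<open>g\<close> is the two-by-two matrix of an arbitrary operator on qubit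
  \<open>q\<close>, indexed by Alice's bit and Bob's bit; the absence of an error is
  included.\<close>

definition single_errors :: "nat \<Rightarrow> (nat \<Rightarrow> nat \<Rightarrow> complex) set" where
  "single_errors n = {M. \<exists>q<n. \<exists>g. \<forall>x<2 ^ n. \<forall>y<2 ^ n.
     M x y = (if \<forall>p<n. p \<noteq> q \<longrightarrow> bit x p = bit y p then g (bit x q) (bit y q) else 0)}"

text \<open>A flip at any position changes the total parity, so comparing parities separates the
  diagonal from the off-diagonal part. One pair is spent here and \<open>m\<close> in either
  continuation, which leaves \<open>n - 1 - m = k\<close>.\<close>

lemma purifiable_single:
  assumes m: "2 \<le> m" and n: "n = 2 ^ m - 1"
  shows "purifiable (2 ^ m - m - 2) (2 ^ n) (2 ^ n) (single_errors n)"
proof -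
  define k where "k = 2 ^ m - m - 2"
  have kn: "k + m = n - 1" "0 < n" using Suc_le_two_power[OF m] by (auto simp: k_def n)
  define h where "h x \<longleftrightarrow> parity_sign {..<n} x = 1" for x
  define V where "V \<alpha> = {x. x < 2 ^ n \<and> h x = \<alpha>}" for \<alpha>
  have h_flip: "h (xor x (2 ^ q)) \<longleftrightarrow> \<not> h x" if "q < n" for x q
    using that parity_sign_cases[of "{..<n}" x] by (auto simp: h_def parity_sign_xor parity_sign_two_power)
  have cV: "card (V \<alpha>) = 2 ^ (n - 1)" for \<alpha> using card_parity_class[OF kn(2)] by (simp add: V_def h_def)
  have flip: "purifiable k (2 ^ n) (2 ^ n) (flip_errors n (V \<alpha>) {..<n})" for \<alpha>
  proof (rule purifiable_flip[OF _ _ _ _ cV])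
    show "card {..<n} \<le> 2 ^ m" by (simp add: n)
    show "k + m \<le> n - 1" using kn by simp
    show "V \<alpha> \<subseteq> {..<2 ^ n}" by (auto simp: V_def)
    show "xor x (xor (2 ^ a) (2 ^ b)) \<in> V \<alpha>" if "x \<in> V \<alpha>" "a \<in> {..<n}" "b \<in> {..<n}" for x a b
      using that by (auto simp: V_def xor.assoc[symmetric] h_flip intro!: xor_less_two_power)
    show "parity_sign {..<n} x = (if \<alpha> then 1 else -1)" if "x \<in> V \<alpha>" for x
      using that parity_sign_cases[of "{..<n}" x] by (auto simp: V_def h_def)
  qed (use kn in auto)
  have phase: "purifiable k (2 ^ n) (2 ^ n) (phase_errors n (V \<alpha>))" for \<alpha>
    unfolding k_def by (rule purifiable_phase[OF m n]) (simp add: V_def h_def)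
  have "purifiable k (2 ^ n) (2 ^ n) (single_errors n)"
  proof (rule purifiable_measure_both[where h = h and
        \<N> = "\<lambda>\<alpha> \<beta>. if \<alpha> = \<beta> then phase_errors n (V \<alpha>) else flip_errors n (V \<alpha>) {..<n}"])
    show "purifiable k (2 ^ n) (2 ^ n) (if \<alpha> = \<beta> then phase_errors n (V \<alpha>) else flip_errors n (V \<alpha>) {..<n})" for \<alpha> \<beta>
      using flip phase by simp
    fix \<alpha> \<beta> and M M' :: "nat \<Rightarrow> nat \<Rightarrow> complex"
    assume "M \<in> single_errors n"
      and M': "\<And>x y. x < 2 ^ n \<Longrightarrow> y < 2 ^ n \<Longrightarrow> M' x y = (if h x = \<alpha> \<and> h y = \<beta> then M x y else 0)"
    then obtain q g where q: "q < n" and M: "\<And>x y. x < 2 ^ n \<Longrightarrow> y < 2 ^ n \<Longrightarrow>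
        M x y = (if \<forall>p<n. p \<noteq> q \<longrightarrow> bit x p = bit y p then g (bit x q) (bit y q) else 0)"
      unfolding single_errors_def by blast
    have flipped: "bit (xor x (2 ^ q)) q \<longleftrightarrow> \<not> bit x q" for x :: nat by (simp add: bit_xor_iff bit_two_power)
    have M2: "M x y = (if y = x then g (bit x q) (bit x q) else
        if y = xor x (2 ^ q) then g (bit x q) (\<not> bit x q) else 0)" if "x < 2 ^ n" "y < 2 ^ n" for x y
      using flipped[of x] unfolding M[OF that] agree_off_iff_flip[OF that] by auto
    show "M' \<in> (if \<alpha> = \<beta> then phase_errors n (V \<alpha>) else flip_errors n (V \<alpha>) {..<n})"
    proof (cases "\<alpha> = \<beta>")
      case True
      have "M' x y = (if x \<in> V \<alpha> \<and> y = x then g (bit x q) (bit x q) else 0)" if "x < 2 ^ n" "y < 2 ^ n" for x y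
        using that True M'[OF that] M2[OF that] h_flip[OF q, of x] by (auto simp: V_def)
      then show ?thesis using True q unfolding phase_errors_def
        by (auto intro!: exI[of _ q] exI[of _ "\<lambda>b. g b b"])
    next
      case False
      have "M' x y = (if x \<in> V \<alpha> \<and> y = xor x (2 ^ q) then g (bit x q) (\<not> bit x q) else 0)"
        if "x < 2 ^ n" "y < 2 ^ n" for x y
        using that False M'[OF that] M2[OF that] h_flip[OF q, of x] by (auto simp: V_def)
      then show ?thesis using False q unfolding flip_errors_def
        by (auto intro!: bexI[of _ q] exI[of _ "\<lambda>b. g b (\<not> b)"])
    qed
  qed
  then show ?thesis by (simp add: k_def)
qed

text \<open>The amplitude matrix of EPR pairs is a multiple of the identity, so an operator on Bob's
  side appears as its own transpose up to scale, and each Kraus operator yields one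
  component.\<close>

lemma noisy_pairs_eq_mixture:
  assumes S: "S \<subseteq> {..<n}" "card S \<le> 1" and n: "0 < n"
  obtains Ms where "noisy_pairs n S Fs = mixture (2 ^ n) (2 ^ n) Ms" "set Ms \<subseteq> single_errors n"
proof -
  let ?E = "\<lambda>x y. of_bool (x = y) / complex_of_real (sqrt 2) ^ n"
  have oq: "set (map (on_qubits n S) Fs) \<subseteq> carrier_mat (2 ^ n) (2 ^ n)" by (auto simp: on_qubits_def)
  have mix: "noisy_pairs n S Fs = mixture (2 ^ n) (2 ^ n)
      (concat (map (\<lambda>K. map (act_right (2 ^ n) K) [?E]) (map (on_qubits n S) Fs)))"
    unfolding noisy_pairs_def ket_bra_epr_state apply_kraus_right[OF oq, symmetric] by (simp add: comp_def)
  have "act_right (2 ^ n) (on_qubits n S F) ?E \<in> single_errors n" for F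
  proof -
    let ?w = "complex_of_real (sqrt 2) ^ n"
    have a: "act_right (2 ^ n) (on_qubits n S F) ?E x y =
        (if \<forall>p<n. p \<notin> S \<longrightarrow> bit x p = bit y p then F $$ (sub_index S y, sub_index S x) / ?w else 0)"
      if "x < 2 ^ n" "y < 2 ^ n" for x y
    proof -
      have "act_right (2 ^ n) (on_qubits n S F) ?E x y =
          (\<Sum>z<2 ^ n. if z = x then on_qubits n S F $$ (y, x) / ?w else 0)"
        unfolding act_right_def by (intro sum.cong refl) auto
      then show ?thesis using that by (auto simp: on_qubits_def)
    qed
    have "finite S" using S(1) finite_subset by blast
    then consider "S = {}" | q where "S = {q}" "q < n"
      using S by (metis card_0_eq card_1_singletonE insert_subset le_neq_implies_less lessThan_iff less_one)
    then show ?thesis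
    proof cases
      \<comment> \<open>On no qubits \<open>F\<close> is a scalar; a multiple of the identity is
        viewed as an error at position 0, which exists since \<open>n\<close> is positive.\<close>
      case 1
      have "(\<forall>p<n. bit x p = bit y p) \<longleftrightarrow> (\<forall>p<n. p \<noteq> 0 \<longrightarrow> bit x p = bit y p) \<and> bit x 0 = bit y 0" for x y :: nat
        using n by auto
      then show ?thesis unfolding single_errors_def using n a
        by (auto simp: 1 sub_index_def intro!: exI[of _ 0] exI[of _ "\<lambda>u v. if u = v then F $$ (0, 0) / ?w else 0"])
    next
      \<comment> \<open>The arguments of \<open>F\<close> are swapped in the witness because of the
        transpose.\<close>
      case 2
      then show ?thesis unfolding single_errors_def using a
        by (auto simp: sub_index_def intro!: exI[of _ q] exI[of _ "\<lambda>u v. F $$ (of_bool v, of_bool u) / ?w"])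
    qed
  qed
  then show ?thesis by (intro that[OF mix]) auto
qed

lemma purifiable_imp_protocol:
  assumes "purifiable k (2 ^ n) (2 ^ n) (single_errors n)" "0 < n"
  shows "\<exists>P. is_two_epp P n \<and> produces_good_pairs P k n 1"
proof -
  obtain P where P: "wf_epp P (2 ^ n) (2 ^ n)"
      "\<And>Ms. set Ms \<subseteq> single_errors n \<Longrightarrow> good_outputs k (branches P (2 ^ n) (2 ^ n) (mixture (2 ^ n) (2 ^ n) Ms))"
    using assms(1) unfolding purifiable_def by blast
  have "good_outputs k (branches P (2 ^ n) (2 ^ n) (noisy_pairs n S Fs))"
    if "S \<subseteq> {..<n}" "card S \<le> 1" for S Fs
    using noisy_pairs_eq_mixture[OF that assms(2)] P(2) by metis
  then show ?thesis
    using P(1) unfolding is_two_epp_def produces_good_pairs_def good_outputs_def by blast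
qed

text \<open>Here \<open>n = k + m + 1\<close>, so the bound would require
  \<open>1 + 3 * (2 ^ m - 1) \<le> 2 * 2 ^ m\<close>, which fails once \<open>2 ^ m\<close> exceeds
  2.\<close>

lemma exceeds_quantum_Hamming_bound:
  assumes "2 \<le> m"
  shows "\<not> quantum_hamming_bound (2 ^ m - 1) (2 ^ m - m - 2) 1"
proof -
  define k where "k = 2 ^ m - m - 2"
  have km: "2 ^ m - 1 = k + Suc m" using Suc_le_two_power[OF assms] by (simp add: k_def)
  have "4 \<le> (2::nat) ^ m" using power_increasing[OF assms, of "2::nat"] by simp
  then have "2 * 2 ^ m < 1 + 3 * ((2::nat) ^ m - 1)" by simp
  then have "2 ^ k * (2 * 2 ^ m) < 2 ^ k * (1 + 3 * ((2::nat) ^ m - 1))" by (intro mult_strict_left_mono) simp_all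
  then have "(2::nat) ^ (2 ^ m - 1) < 2 ^ k * (1 + 3 * (2 ^ m - 1))" unfolding km by (simp add: power_add)
  then show ?thesis by (simp add: quantum_hamming_bound_def k_def)
qed

theorem mainTheorem4:
  fixes m :: nat
  assumes "2 \<le> m"
  shows "(\<exists>P. is_two_epp P (2 ^ m - 1) \<and>
              produces_good_pairs P (2 ^ m - m - 2) (2 ^ m - 1) 1) \<and>
         \<not> quantum_hamming_bound (2 ^ m - 1) (2 ^ m - m - 2) 1"
proof
  have "0 < (2::nat) ^ m - 1" using Suc_le_two_power[OF assms] by simp
  then show "\<exists>P. is_two_epp P (2 ^ m - 1) \<and> produces_good_pairs P (2 ^ m - m - 2) (2 ^ m - 1) 1"
    by (intro purifiable_imp_protocol purifiable_single[OF assms refl])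
qed (rule exceeds_quantum_Hamming_bound[OF assms])

end
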